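(* For every integer $n\ge 2$, each of the polynomials $P_{K_{1,1,n}}(x)$ and $P_{K_{2,n}}(x)$, the Kazhdan--Lusztig polynomials of the graphic matroids of the complete tripartite graph $K_{1,1,n}$ and of the complete bipartite graph $K_{2,n}$ respectively, has exactly $\lfloor n/2\rfloor$ (complex) zeros, all of which are negative real numbers and simple.
   Context: $K_{1,1,n}$ is the complete tripartite graph with parts of sizes $1,1,n$; equivalently, it is $K_{2,n}$ together with an edge joining the two vertices of the part of size $2$. Kazhdan--Lusztig polynomial of a matroid (Elias--Proudfoot--Wakefield): to every loopless matroid $M$ on a finite ground set there is a unique way to assign a polynomial $P_M(x)\in\mathbb Z[x]$ such that (1) if $\operatorname{rk}M=0$ then $P_M(x)=1$; (2) if $\operatorname{rk}M>0$ then $\deg P_M<\tfrac12\operatorname{rk}M$; (3) for every $M$, $x^{\operatorname{rk}M}P_M(x^{-1})=\sum_{F}\chi_{M|F}(x)\,P_{M/F}(x)$, where $F$ ranges over the flats of $M$, $M|F$ is the restriction of $M$ to $F$, $M/F$ is the contraction of $M$ by $F$, and $\chi_{N}(x)=\sum_{G}\mu_N(\emptyset,G)\,x^{\operatorname{rk}N-\operatorname{rk}G}$ (sum over flats $G$ of $N$, $\mu_N$ the Möbius function of the lattice of flats) is the characteristic polynomial. For a graph $G$, $P_G$ denotes the Kazhdan--Lusztig polynomial of its graphic matroid. *)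

theory Defs
  imports Complex_Main "HOL-Computational_Algebra.Polynomial"
begin

section \<open>Finite matroids\<close>

datatype 'a matroid = Matroid (ground: "'a set") (indeps: "'a set set")

definition is_matroid :: "'a matroid \<Rightarrow> bool" where
  "is_matroid M \<longleftrightarrow>
     finite (ground M) \<and> indeps M \<subseteq> Pow (ground M) \<and> {} \<in> indeps M \<and>
     (\<forall>I\<in>indeps M. \<forall>J. J \<subseteq> I \<longrightarrow> J \<in> indeps M) \<and>
     (\<forall>I\<in>indeps M. \<forall>J\<in>indeps M. card I < card J \<longrightarrow> (\<exists>e\<in>J - I. insert e I \<in> indeps M))"

definition loopless :: "'a matroid \<Rightarrow> bool" where
  "loopless M \<longleftrightarrow> (\<forall>e\<in>ground M. {e} \<in> indeps M)"

definition rank_of :: "'a matroid \<Rightarrow> 'a set \<Rightarrow> nat" where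
  "rank_of M X = Max (card ` {I \<in> indeps M. I \<subseteq> X})"

definition rk :: "'a matroid \<Rightarrow> nat" where
  "rk M = rank_of M (ground M)"

definition is_flat :: "'a matroid \<Rightarrow> 'a set \<Rightarrow> bool" where
  "is_flat M F \<longleftrightarrow>
     F \<subseteq> ground M \<and> (\<forall>e\<in>ground M - F. rank_of M F < rank_of M (insert e F))"

definition flats :: "'a matroid \<Rightarrow> 'a set set" where
  "flats M = {F. is_flat M F}"

definition restriction :: "'a matroid \<Rightarrow> 'a set \<Rightarrow> 'a matroid" where
  "restriction M F = Matroid F {I \<in> indeps M. I \<subseteq> F}"

definition is_basis_of :: "'a matroid \<Rightarrow> 'a set \<Rightarrow> 'a set \<Rightarrow> bool" where
  "is_basis_of M X B \<longleftrightarrow>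
     B \<in> indeps M \<and> B \<subseteq> X \<and> (\<forall>e\<in>X - B. insert e B \<notin> indeps M)"

definition contraction :: "'a matroid \<Rightarrow> 'a set \<Rightarrow> 'a matroid" where
  "contraction M F = Matroid (ground M - F)
     {I. I \<subseteq> ground M - F \<and> (\<exists>B. is_basis_of M F B \<and> I \<union> B \<in> indeps M)}"


section \<open>Characteristic and Kazhdan--Lusztig polynomials\<close>

text \<open>The Moebius function of a family \<open>L\<close> of finite sets ordered by inclusion, for arguments
  \<open>A\<close>, \<open>B\<close> in \<open>L\<close>. The test \<open>finite B\<close> only serves termination.\<close>

function mobius :: "'a set set \<Rightarrow> 'a set \<Rightarrow> 'a set \<Rightarrow> int" where
  "mobius L A B =
     (if A = B then 1
      else if A \<subset> B \<and> finite B then - (\<Sum>C | C \<in> L \<and> A \<subseteq> C \<and> C \<subset> B. mobius L A C)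
      else 0)"
  by pat_completeness auto
termination
  by (relation "measure (\<lambda>(L, A, B). card B)") (auto intro: psubset_card_mono)

declare mobius.simps [simp del]

definition char_poly_matroid :: "'a matroid \<Rightarrow> int poly" where
  "char_poly_matroid N =
     (\<Sum>G\<in>flats N. monom (mobius (flats N) {} G) (rk N - rk (restriction N G)))"

text \<open>The last condition is an identity of Laurent polynomials in \<open>x\<close>, expressed by evaluation at
  all nonzero reals. All minors of \<open>M\<close> live on subsets of its ground set, so it is
  enough to consider assignments on the matroids over one type of elements.\<close>

definition KL_assignment :: "('a matroid \<Rightarrow> int poly) \<Rightarrow> bool" where
  "KL_assignment P \<longleftrightarrow>
     (\<forall>M. is_matroid M \<and> loopless M \<longrightarrow>
        (rk M = 0 \<longrightarrow> P M = 1) \<and>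
        (rk M > 0 \<longrightarrow> real (degree (P M)) < real (rk M) / 2) \<and>
        (\<forall>x::real. x \<noteq> 0 \<longrightarrow>
           x ^ rk M * poly (map_poly of_int (P M)) (inverse x) =
           (\<Sum>F\<in>flats M.
              poly (map_poly of_int (char_poly_matroid (restriction M F))) x *
              poly (map_poly of_int (P (contraction M F))) x)))"

definition KL_poly :: "'a matroid \<Rightarrow> int poly" where
  "KL_poly M = (THE p. \<exists>P. KL_assignment P \<and> P M = p)"


section \<open>Graphic matroids of complete multipartite graphs\<close>

text \<open>A simple graph is given by its set of edges, each a two-element set of vertices.\<close>

definition is_cycle :: "'v set set \<Rightarrow> 'v list \<Rightarrow> bool" where
  "is_cycle X vs \<longleftrightarrow>
     length vs \<ge> 3 \<and> distinct vs \<and>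
     (\<forall>i<length vs. {vs ! i, vs ! (Suc i mod length vs)} \<in> X)"

definition graphic_matroid :: "'v set set \<Rightarrow> 'v set matroid" where
  "graphic_matroid E = Matroid E {X. X \<subseteq> E \<and> (\<nexists>vs. is_cycle X vs)}"

text \<open>The vertex \<open>(i, k)\<close> is the \<open>k\<close>-th vertex of the \<open>i\<close>-th part.\<close>

definition complete_multipartite :: "nat list \<Rightarrow> (nat \<times> nat) set set" where
  "complete_multipartite ns =
     {{(i, k), (j, l)} | i k j l.
        i < length ns \<and> k < ns ! i \<and> j < length ns \<and> l < ns ! j \<and> i \<noteq> j}"

end

theory Submission
  imports Defs
begin

text \<open>Write \<open>r\<close> for the rank function of a matroid \<open>M\<close>. Summing the defining identity of the
  Kazhdan--Lusztig polynomials over the lattice of flats removes the characteristic polynomials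
  from it: since \<open>\<chi>\<close> is the Moebius function applied to the powers \<open>x ^ r F\<close>, the identity for
  all minors follows by Moebius inversion once every sum
  \<open>Z\<^sub>M(x) = (\<Sum>F. x ^ r F * P\<^bsub>M/F\<^esub>(x))\<close> is palindromic of degree \<open>rk M\<close>
  (\<open>KL_identity_of_self_reciprocal\<close>). In this form existence is a matter of comparing
  coefficients: the flats \<open>F \<noteq> {}\<close> prescribe \<open>P\<^sub>M\<close> in the degrees below half of the rank
  (\<open>KL_rec\<close>). To compute a Kazhdan--Lusztig polynomial it then suffices to guess one polynomial
  for each flat, to bound its degree and to check palindromicity (\<open>KL_poly_eqI\<close>).

  In \<open>K\<^bsub>1,1,n\<^esub>\<close>, let the spine be the edge joining the two vertices \<open>a\<close>, \<open>b\<close> of degree \<open>n + 1\<close>.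
  A flat either does not link \<open>a\<close> to \<open>b\<close>, and then the contraction is, up to parallel edges, the
  matroid of a smaller \<open>K\<^bsub>1,1,m\<^esub>\<close>, or it does, and then the contraction is Boolean up to parallel
  edges and has polynomial \<open>1\<close>. So the polynomials \<open>t\<^sub>n\<close> of \<open>K\<^bsub>1,1,n\<^esub>\<close> are the
  polynomials of degree at most \<open>n / 2\<close> for which
  \<open>(\<Sum>j\<le>n. (n choose j) * (2 * x) ^ j * t\<^bsub>n-j\<^esub>(x)) + x * (1 + x) ^ n\<close> is palindromic of degree
  \<open>n + 1\<close>. They satisfy \<open>t\<^bsub>n+1\<^esub> = (1 - x) * t\<^sub>n + x * N\<^sub>n\<close> where \<open>N\<^sub>n\<close> counts two-coloured Motzkin
  paths by up steps; the binomial transform with parameter \<open>2 * x\<close> replaces the weight \<open>2\<close> of a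
  level step by \<open>2 + 2 * x\<close>, which makes the transform of \<open>N\<^sub>n\<close> visibly palindromic
  (\<open>self_reciprocal_thag_Z\<close>). Deleting the spine removes from the sum the one linking flat \<open>{spine}\<close>,
  which contributes \<open>x\<close>. Adding \<open>x\<close> to the term of the empty flat repairs this and respects the degree
  bound if \<open>n \<ge> 2\<close>, so \<open>K\<^bsub>2,n\<^esub>\<close> has the polynomial \<open>t\<^sub>n + x\<close> (\<open>KL_poly_thag_matroid\<close>).

  The zeros are located by interlacing. With \<open>p\<^sub>n = (x * N\<^sub>n)'\<close>, a rescaled Legendre polynomial, one
  has \<open>(n + 1) * t\<^sub>n + (1 - x) * t\<^sub>n' = p\<^sub>n\<close> and \<open>(n + 3) * N\<^bsub>n+1\<^esub> = 2 * (n + 1) * N\<^sub>n + 2 * p\<^bsub>n+1\<^esub>\<close>.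
  If \<open>N\<^sub>n\<close> has alternating signs at the roots of \<open>t\<^sub>n\<close>, so has \<open>t\<^bsub>n+1\<^esub> = x * N\<^sub>n\<close>, and \<open>t\<^bsub>n+1\<^esub>\<close> gets
  its roots from the intermediate value theorem. At the new roots \<open>p\<^bsub>n+1\<^esub> = (1 - x) * t\<^bsub>n+1\<^esub>'\<close>
  alternates, \<open>N\<^sub>n\<close> has the sign of \<open>t\<^sub>n\<close>, hence \<open>N\<^bsub>n+1\<^esub>\<close> alternates as well and the induction
  continues (\<open>aligned_Suc\<close>). The polynomial \<open>t\<^bsub>n+1\<^esub> + x\<close> takes the value \<open>x * (N\<^sub>n + 1)\<close> at a root
  of \<open>t\<^sub>n\<close>, so the same argument applies as soon as \<open>\<bar>N\<^sub>n\<bar> > 1\<close> there (\<open>abs_motzkin_gt_1\<close>).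
  This holds because a positive quadratic form in \<open>p\<^bsub>n+1\<^esub>\<close> and \<open>N\<^sub>n\<close>, the Sonin function of the
  Legendre polynomials, grows exponentially in \<open>n\<close> (\<open>energy_Suc\<close>), while it would be at most
  quadratic in \<open>n\<close> if \<open>N\<^sub>n\<close> were small.\<close>

section \<open>Evaluating integer polynomials in other rings\<close>

lemma map_poly_of_int_add:
  "map_poly of_int (p + q) = (map_poly of_int p + map_poly of_int q :: 'a::comm_ring_1 poly)"
  by (rule poly_eqI) (simp add: coeff_map_poly)

lemma map_poly_of_int_minus:
  "map_poly of_int (- p) = (- map_poly of_int p :: 'a::comm_ring_1 poly)"
  by (rule poly_eqI) (simp add: coeff_map_poly)

lemma map_poly_of_int_diff:
  "map_poly of_int (p - q) = (map_poly of_int p - map_poly of_int q :: 'a::comm_ring_1 poly)"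
  by (rule poly_eqI) (simp add: coeff_map_poly)

lemma map_poly_of_int_mult:
  "map_poly of_int (p * q) = (map_poly of_int p * map_poly of_int q :: 'a::comm_ring_1 poly)"
  by (rule poly_eqI) (simp add: coeff_map_poly coeff_mult)

lemma map_poly_of_int_pderiv:
  "map_poly of_int (pderiv p) = (pderiv (map_poly of_int p) :: 'a::idom poly)"
  by (rule poly_eqI) (simp add: coeff_map_poly coeff_pderiv)

lemma map_poly_of_int_smult:
  "map_poly of_int (smult c p) = (smult (of_int c) (map_poly of_int p) :: 'a::comm_ring_1 poly)"
  by (rule poly_eqI) (simp add: coeff_map_poly)

lemma map_poly_of_int_sum:
  "map_poly of_int (sum f S) = (\<Sum>i\<in>S. map_poly of_int (f i) :: 'a::comm_ring_1 poly)"
  by (rule poly_eqI) (simp add: coeff_map_poly coeff_sum)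

lemmas map_poly_of_int_simps =
  map_poly_of_int_add map_poly_of_int_minus map_poly_of_int_diff map_poly_of_int_mult
  map_poly_of_int_pderiv map_poly_of_int_smult map_poly_of_int_sum map_poly_monom map_poly_pCons

lemma degree_map_poly_of_int [simp]:
  "degree (map_poly of_int p :: 'a::ring_char_0 poly) = degree p"
  by (rule degree_map_poly) auto

abbreviation real_poly :: "int poly \<Rightarrow> real poly" where
  "real_poly \<equiv> map_poly of_int"

section \<open>Three families of integer polynomials\<close>

definition catalan :: "nat \<Rightarrow> nat" where
  "catalan k = ((2 * k) choose k) div Suc k"

lemma Suc_mult_catalan: "Suc k * catalan k = (2 * k) choose k"
proof -
  have "Suc k * ((2 * k) choose Suc k) = k * ((2 * k) choose k)"
    using binomial_absorb_comp[of "2 * k" k] binomial_absorption[of k "2 * k"]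
    by (metis add_diff_cancel_left' mult_2)
  then have "Suc k * ((2 * k) choose k) =
      Suc k * ((2 * k) choose Suc k) + ((2 * k) choose k)"
    by simp
  then have "Suc k dvd ((2 * k) choose k)"
    by (metis dvd_add_right_iff dvd_triv_left)
  then show ?thesis unfolding catalan_def by (rule dvd_mult_div_cancel)
qed

text \<open>The ratio of consecutive Catalan numbers, which turns the recurrences below into identities of
  binomial coefficients.\<close>

lemma catalan_Suc: "(k + 2) * catalan (Suc k) = 2 * (2 * k + 1) * catalan k"
proof -
  have "Suc k * ((2 * k + 2) choose Suc k) = (2 * k + 2) * ((2 * k + 1) choose k)"
    using Suc_times_binomial[of k "2 * k + 1"] by simp
  moreover have "Suc k * ((2 * k + 1) choose k) = (2 * k + 1) * ((2 * k) choose k)"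
    using binomial_absorb_comp[of "2 * k + 1" k] by simp
  ultimately have "Suc k * (Suc k * ((2 * k + 2) choose Suc k)) =
      (2 * k + 2) * ((2 * k + 1) * ((2 * k) choose k))"
    by (metis mult.left_commute)
  moreover have "(2 * k + 2) choose Suc k = (k + 2) * catalan (Suc k)"
    using Suc_mult_catalan[of "Suc k"] by simp
  ultimately have "Suc k * (Suc k * ((k + 2) * catalan (Suc k))) =
      (2 * k + 2) * ((2 * k + 1) * (Suc k * catalan k))"
    by (metis Suc_mult_catalan)
  also have "\<dots> = Suc k * (Suc k * (2 * (2 * k + 1) * catalan k))"
    by (simp add: algebra_simps)
  finally show ?thesis by (metis mult_cancel1 nat.distinct(1))
qed

text \<open>The weighted count of Motzkin paths of length \<open>n\<close> whose level steps have two colours, with \<open>x\<close>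
  marking up steps: choose the \<open>2 * k\<close> positions of the other steps and a Dyck path on them.\<close>

definition motzkin :: "nat \<Rightarrow> int poly" where
  "motzkin n = (\<Sum>k\<le>n. monom (int ((n choose (2 * k)) * catalan k * 2 ^ (n - 2 * k))) k)"

lemma coeff_motzkin: "coeff (motzkin n) k = int ((n choose (2 * k)) * catalan k * 2 ^ (n - 2 * k))"
proof -
  have "coeff (motzkin n) k =
      (\<Sum>i\<le>n. if i = k then int ((n choose (2 * k)) * catalan k * 2 ^ (n - 2 * k)) else 0)"
    unfolding motzkin_def coeff_sum by (rule sum.cong) auto
  then show ?thesis by (cases "k \<le> n") (simp_all add: binomial_eq_0)
qed

text \<open>For \<open>x = 1 - 1 / z\<^sup>2\<close> the value is \<open>(2 / z) ^ n\<close> times the Legendre polynomial \<open>P\<^sub>n(z)\<close>. Up to a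
  power of \<open>z\<close> and a constant, \<open>motzkin n\<close> is the derivative \<open>P\<^bsub>n+1\<^esub>'(z)\<close>.\<close>

definition legendre :: "nat \<Rightarrow> int poly" where
  "legendre n = pderiv (pCons 0 (motzkin n))"

lemma coeff_legendre: "coeff (legendre n) k = int (Suc k) * coeff (motzkin n) k"
  by (simp add: legendre_def coeff_pderiv)

text \<open>In degree \<open>k\<close> this is the absorption rule
  \<open>(n + 1 - 2 * k) * (n + 1 choose 2 * k) = (n + 1) * (n choose 2 * k)\<close>.\<close>

lemma motzkin_Suc:
  "smult (int n + 3) (motzkin (Suc n)) = smult (2 * (int n + 1)) (motzkin n) + smult 2 (legendre (Suc n))"
proof (rule poly_eqI)
  fix k
  have *: "(Suc n - 2 * k) * (Suc n choose (2 * k)) = Suc n * (n choose (2 * k))"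
    using binomial_absorb_comp[of "Suc n" "2 * k"] by simp
  have "(int n + 1 - 2 * int k) * coeff (motzkin (Suc n)) k = 2 * (int n + 1) * coeff (motzkin n) k"
  proof (cases "2 * k \<le> n")
    case True
    have "(int n + 1 - 2 * int k) * coeff (motzkin (Suc n)) k =
        int ((Suc n - 2 * k) * (Suc n choose (2 * k)) * catalan k * 2 ^ (Suc n - 2 * k))"
      using True by (simp add: coeff_motzkin of_nat_diff)
    also have "\<dots> = 2 * (int n + 1) * coeff (motzkin n) k"
      unfolding * using True by (simp add: coeff_motzkin Suc_diff_le) (simp add: algebra_simps)
    finally show ?thesis .
  next
    case False
    then show ?thesis
      by (cases "2 * k = Suc n") (auto simp: coeff_motzkin binomial_eq_0)
  qed
  then show "coeff (smult (int n + 3) (motzkin (Suc n))) k =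
      coeff (smult (2 * (int n + 1)) (motzkin n) + smult 2 (legendre (Suc n))) k"
    by (simp add: coeff_legendre algebra_simps)
qed

text \<open>In degree \<open>j + 1\<close> the Pascal rule leaves \<open>n choose (2 * j + 1)\<close> on one side, and the recurrence of
  the Catalan numbers converts it into \<open>n choose (2 * j)\<close>. Negative powers of \<open>2\<close> would occur when
  \<open>2 * j \<ge> n\<close>; all terms vanish there.\<close>

lemma legendre_Suc:
  "legendre (Suc n) = smult 2 ([:1, -1:] * legendre n) + smult (int n + 2) (pCons 0 (motzkin n))"
proof (rule poly_eqI)
  fix k
  show "coeff (legendre (Suc n)) k =
    coeff (smult 2 ([:1, -1:] * legendre n) + smult (int n + 2) (pCons 0 (motzkin n))) k"
  proof (cases k)
    case 0
    then show ?thesis by (simp add: coeff_legendre coeff_motzkin)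
  next
    case (Suc j)
    have "int (j + 2) * (coeff (motzkin (Suc n)) (Suc j) - 2 * coeff (motzkin n) (Suc j)) =
        (int n - 2 * int j) * coeff (motzkin n) j"
    proof (cases "2 * j < n")
      case True
      have *: "(n - 2 * j) * (n choose (2 * j)) = Suc (2 * j) * (n choose Suc (2 * j))"
        using binomial_absorb_comp[of n "2 * j"] binomial_absorption[of "2 * j" n] by simp
      have "(int n - 2 * int j) * int (n choose (2 * j)) = int ((n - 2 * j) * (n choose (2 * j)))"
        using True by (simp add: of_nat_diff)
      then have R: "(int n - 2 * int j) * coeff (motzkin n) j =
          int (Suc (2 * j) * (n choose Suc (2 * j)) * catalan j * 2 ^ (n - 2 * j))"
        unfolding * by (simp add: coeff_motzkin)
      have e: "n - 2 * j = Suc (n - Suc (2 * j))"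
        using True by simp
      have A: "2 * coeff (motzkin n) (Suc j) =
          int ((n choose Suc (Suc (2 * j))) * catalan (Suc j) * 2 ^ (n - Suc (2 * j)))"
      proof (cases "n = Suc (2 * j)")
        case False
        then have "n - Suc (2 * j) = Suc (n - Suc (Suc (2 * j)))" using True by simp
        then show ?thesis by (simp add: coeff_motzkin)
      qed (simp add: coeff_motzkin binomial_eq_0)
      have B: "coeff (motzkin (Suc n)) (Suc j) =
          int ((Suc n choose Suc (Suc (2 * j))) * catalan (Suc j) * 2 ^ (n - Suc (2 * j)))"
        by (simp add: coeff_motzkin)
      have "int (j + 2) * (coeff (motzkin (Suc n)) (Suc j) - 2 * coeff (motzkin n) (Suc j)) =
          int ((n choose Suc (2 * j)) * ((j + 2) * catalan (Suc j)) * 2 ^ (n - Suc (2 * j)))"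
        unfolding A B by (simp add: algebra_simps)
      also have "\<dots> = int (Suc (2 * j) * (n choose Suc (2 * j)) * catalan j * 2 ^ (n - 2 * j))"
        unfolding catalan_Suc e by (simp add: algebra_simps)
      finally show ?thesis unfolding R .
    next
      case False
      then show ?thesis by (cases "n = 2 * j") (auto simp: coeff_motzkin binomial_eq_0)
    qed
    then show ?thesis
      using Suc by (simp add: coeff_legendre algebra_simps)
  qed
qed

text \<open>These will be the Kazhdan--Lusztig polynomials of \<open>K\<^bsub>1,1,n\<^esub>\<close>. Neither the degree nor the sign of
  the leading coefficient can be read off the recurrence, in which the leading terms cancel for
  even \<open>n\<close>.\<close>

fun thag_poly :: "nat \<Rightarrow> int poly" where
  "thag_poly 0 = 1"
| "thag_poly (Suc n) = [:1, -1:] * thag_poly n + pCons 0 (motzkin n)"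

text \<open>The link between \<open>thag_poly n\<close> and its derivative. It determines the degree of \<open>thag_poly n\<close>, and
  it gives the sign of \<open>legendre n\<close> at the roots of \<open>thag_poly n\<close>.\<close>

lemma thag_ode: "smult (int n + 1) (thag_poly n) + [:1, -1:] * pderiv (thag_poly n) = legendre n"
proof (induction n)
  case 0
  show ?case by (simp add: legendre_def motzkin_def catalan_def pderiv_pCons)
next
  case (Suc n)
  have d: "pderiv (thag_poly (Suc n)) = [:1, -1:] * pderiv (thag_poly n) - thag_poly n + legendre n"
    unfolding thag_poly.simps pderiv_add pderiv_mult legendre_def
    by (rule poly_ext) (simp add: pderiv_pCons algebra_simps)
  have "smult (int (Suc n) + 1) (thag_poly (Suc n)) + [:1, -1:] * pderiv (thag_poly (Suc n)) =
      [:1, -1:] * (smult (int n + 1) (thag_poly n) + [:1, -1:] * pderiv (thag_poly n)) +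
      smult (int n + 2) (pCons 0 (motzkin n)) + [:1, -1:] * legendre n"
    unfolding d unfolding thag_poly.simps
    by (rule poly_ext) (simp add: algebra_simps)
  also have "\<dots> = legendre (Suc n)"
    unfolding Suc.IH legendre_Suc by (rule poly_ext) (simp add: algebra_simps)
  finally show ?case .
qed

lemma degree_legendre_le: "degree (legendre n) \<le> n div 2"
  by (rule degree_le) (auto simp: coeff_legendre coeff_motzkin binomial_eq_0)

lemma coeff_legendre_top: "coeff (legendre n) (n div 2) > 0"
proof -
  have "catalan (n div 2) > 0"
    using Suc_mult_catalan[of "n div 2"] by (metis mult_0_right nat_0_less_mult_iff
        zero_less_binomial_iff le_add1 mult_2 gr0I less_irrefl)
  then show ?thesis by (simp add: coeff_legendre coeff_motzkin)
qed

lemma coeff_thag_0: "coeff (thag_poly n) 0 = 1"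
  by (induction n) auto

lemma coeff_thag:
  "(int n + 1 - int k) * coeff (thag_poly n) k + int (Suc k) * coeff (thag_poly n) (Suc k) = coeff (legendre n) k"
proof -
  have "coeff (legendre n) k =
    coeff (smult (int n + 1) (thag_poly n) + [:1, -1:] * pderiv (thag_poly n)) k" unfolding thag_ode ..
  then show ?thesis by (cases k) (simp_all add: coeff_pderiv algebra_simps)
qed

text \<open>Comparing leading coefficients in \<open>thag_ode\<close>: the left-hand side has leading coefficient
  \<open>n + 1 - degree\<close> times that of \<open>thag_poly n\<close>, which is not zero because the degree is at most
  \<open>n\<close>. So the degree cannot exceed that of \<open>legendre n\<close>.\<close>

lemma degree_thag_le: "degree (thag_poly n) \<le> n div 2"
proof -
  have d: "degree (thag_poly n) \<le> n"
  proof (induction n)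
    case (Suc n)
    have "degree (motzkin n) \<le> n"
      by (rule degree_le) (auto simp: coeff_motzkin binomial_eq_0)
    moreover have "degree ([:1, -1:] * thag_poly n) \<le> Suc n"
      by (rule order.trans[OF degree_mult_le]) (use Suc in simp)
    ultimately show ?case
      by (auto intro!: degree_add_le simp: degree_pCons_eq_if simp del: mult_pCons_left)
  qed simp
  show ?thesis
  proof (rule ccontr)
    assume "\<not> ?thesis"
    then have gt: "n div 2 < degree (thag_poly n)" by simp
    have "(int n + 1 - int (degree (thag_poly n))) * lead_coeff (thag_poly n) = 0"
      using coeff_thag[of n "degree (thag_poly n)"] gt degree_legendre_le[of n]
      by (simp add: coeff_eq_0)
    moreover have "int n + 1 - int (degree (thag_poly n)) \<noteq> 0" using d by simp
    ultimately have "thag_poly n = 0" by simp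
    then show False using coeff_thag_0[of n] by simp
  qed
qed

lemma coeff_thag_top: "coeff (thag_poly n) (n div 2) > 0"
proof -
  have "coeff (thag_poly n) (Suc (n div 2)) = 0"
    by (rule coeff_eq_0) (use degree_thag_le[of n] in simp)
  then have "(int n + 1 - int (n div 2)) * coeff (thag_poly n) (n div 2) > 0"
    using coeff_thag[of n "n div 2"] coeff_legendre_top[of n] by simp
  moreover have "int n + 1 - int (n div 2) > 0" by linarith
  ultimately show ?thesis by (simp add: zero_less_mult_iff)
qed

lemma degree_thag: "degree (thag_poly n) = n div 2"
  using degree_thag_le[of n] coeff_thag_top[of n] by (intro antisym le_degree) auto

lemma catalan_0_1: "catalan 0 = 1" "catalan (Suc 0) = 1"
  using Suc_mult_catalan[of 0] Suc_mult_catalan[of 1] by simp_all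
lemma motzkin_0_1: "motzkin 0 = [:1:]" "motzkin (Suc 0) = [:2:]"
  by (simp_all add: motzkin_def catalan_0_1 monom_0)
lemma motzkin_2_3: "motzkin 2 = [:4, 1:]" "motzkin 3 = [:8, 6:]"
proof -
  have "{..2::nat} = {0, 1, 2}" "{..3::nat} = {0, 1, 2, 3}" by auto
  then show "motzkin 2 = [:4, 1:]" "motzkin 3 = [:8, 6:]"
    by (simp_all add: motzkin_def catalan_0_1 monom_0 monom_Suc binomial_eq_0 choose_two)
qed
lemma thag_2_3: "thag_poly 2 = [:1, 1:]" "thag_poly 3 = [:1, 4:]"
proof -
  have "thag_poly (Suc (Suc 0)) = [:1, 1:]" by (simp add: motzkin_0_1 one_pCons)
  then show "thag_poly 2 = [:1, 1:]" by (simp add: numeral_2_eq_2)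
  then have "thag_poly (Suc 2) = [:1, 4:]" unfolding thag_poly.simps(2) by (simp add: motzkin_2_3)
  then show "thag_poly 3 = [:1, 4:]" by simp
qed

section \<open>Real polynomials with simple negative roots\<close>

text \<open>The first \<open>degree p\<close> values of \<open>\<rho>\<close> are negative roots of \<open>p\<close> in strictly decreasing order, so
  they are all the roots and they are simple. The order matters because signs at the \<open>i\<close>-th root
  are compared with \<open>(-1) ^ i\<close>.\<close>

definition descending_negative_roots :: "real poly \<Rightarrow> (nat \<Rightarrow> real) \<Rightarrow> bool" where
  "descending_negative_roots p \<rho> \<longleftrightarrow>
     (\<forall>i<degree p. \<rho> i < 0 \<and> poly p (\<rho> i) = 0) \<and>
     (\<forall>i j. i < j \<longrightarrow> j < degree p \<longrightarrow> \<rho> j < \<rho> i)"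

lemma descending_negative_roots_inj_on:
  assumes "descending_negative_roots p \<rho>"
  shows "inj_on \<rho> {..<degree p}"
  using assms unfolding descending_negative_roots_def inj_on_def
  by (metis lessThan_iff less_irrefl linorder_neqE_nat)

lemma degree_linear_prod: "finite A \<Longrightarrow> degree (\<Prod>i\<in>A. [:- r i, 1:]) = card A"
  for r :: "nat \<Rightarrow> 'a::field"
  by (subst degree_prod_eq_sum_degree) auto

lemma descending_negative_roots_factor:
  assumes "descending_negative_roots p \<rho>"
  shows "p = smult (lead_coeff p) (\<Prod>i<degree p. [:- \<rho> i, 1:])" (is "p = smult _ ?q")
proof (rule poly_eqI_degree_lead_coeff[where n = "degree p" and A = "\<rho> ` {..<degree p}"])
  have d: "degree ?q = degree p" by (simp add: degree_linear_prod)
  have "lead_coeff ?q = 1" by (simp add: lead_coeff_prod)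
  with d show "coeff p (degree p) = coeff (smult (lead_coeff p) ?q) (degree p)" by simp
  show "degree p \<le> card (\<rho> ` {..<degree p})"
    by (simp add: card_image descending_negative_roots_inj_on[OF assms])
  show "degree (smult (lead_coeff p) ?q) \<le> degree p"
    using degree_smult_le[of "lead_coeff p" ?q] d by simp
next
  fix z assume "z \<in> \<rho> ` {..<degree p}"
  then obtain i where i: "i < degree p" "z = \<rho> i" by auto
  have "poly ?q z = 0" unfolding poly_prod
    by (rule prod_zero) (use i in auto)
  then show "poly p z = poly (smult (lead_coeff p) ?q) z"
    using assms i by (simp add: descending_negative_roots_def)
qed simp

lemma sign_linear_prod:
  fixes r :: "nat \<Rightarrow> real"
  assumes "finite A" "finite B" "\<And>j. j \<in> A \<Longrightarrow> x < r j" "\<And>j. j \<in> B \<Longrightarrow> r j < x"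
  shows "(-1) ^ card A * (\<Prod>j\<in>A. x - r j) * (\<Prod>j\<in>B. x - r j) > 0"
proof -
  have "(-1) ^ card A * (\<Prod>j\<in>A. x - r j) = (\<Prod>j\<in>A. -1 * (x - r j))"
    by (subst prod.distrib) simp
  also have "\<dots> > 0" by (rule prod_pos) (use assms in auto)
  finally show ?thesis by (rule mult_pos_pos) (use assms in \<open>auto intro!: prod_pos\<close>)
qed

lemma descending_negative_roots_sign:
  assumes "descending_negative_roots p \<rho>" "lead_coeff p > 0" "i \<le> degree p"
    and "\<And>j. j < i \<Longrightarrow> x < \<rho> j" "\<And>j. i \<le> j \<Longrightarrow> j < degree p \<Longrightarrow> \<rho> j < x"
  shows "(-1) ^ i * poly p x > 0"
proof -
  have split: "{..<degree p} = {..<i} \<union> {i..<degree p}" using assms(3) by auto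
  have "poly p x = poly (smult (lead_coeff p) (\<Prod>i<degree p. [:- \<rho> i, 1:])) x"
    using descending_negative_roots_factor[OF assms(1)] by simp
  also have "\<dots> = lead_coeff p * ((\<Prod>j<i. x - \<rho> j) * (\<Prod>j=i..<degree p. x - \<rho> j))"
    by (subst split) (simp add: poly_prod prod.union_disjoint ivl_disj_int)
  finally have "(-1) ^ i * poly p x =
      lead_coeff p * ((-1) ^ card {..<i} * (\<Prod>j<i. x - \<rho> j) * (\<Prod>j=i..<degree p. x - \<rho> j))"
    by simp
  also have "\<dots> > 0"
    by (intro mult_pos_pos sign_linear_prod) (use assms in auto)
  finally show ?thesis .
qed

lemma descending_negative_roots_sign_pderiv:
  assumes "descending_negative_roots p \<rho>" "lead_coeff p > 0" "i < degree p"
  shows "(-1) ^ i * poly (pderiv p) (\<rho> i) > 0"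
proof -
  define q where "q = smult (lead_coeff p) (\<Prod>j\<in>{..<degree p} - {i}. [:- \<rho> j, 1:])"
  have split: "{..<degree p} - {i} = {..<i} \<union> {Suc i..<degree p}" using assms(3) by auto
  have "p = smult (lead_coeff p) (\<Prod>j<degree p. [:- \<rho> j, 1:])"
    by (rule descending_negative_roots_factor[OF assms(1)])
  also have "\<dots> = [:- \<rho> i, 1:] * q"
    unfolding q_def mult_smult_right
    by (subst prod.remove[of _ i]) (use assms(3) in auto)
  finally have p: "p = [:- \<rho> i, 1:] * q" .
  have "poly (pderiv p) (\<rho> i) = poly q (\<rho> i)"
    by (subst p) (simp add: pderiv_mult pderiv_pCons del: mult_pCons_left)
  also have "\<dots> = lead_coeff p * ((\<Prod>j<i. \<rho> i - \<rho> j) * (\<Prod>j=Suc i..<degree p. \<rho> i - \<rho> j))"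
    unfolding q_def by (subst split) (simp add: poly_prod, subst prod.union_disjoint, auto)
  finally have "(-1) ^ i * poly (pderiv p) (\<rho> i) =
      lead_coeff p * ((-1) ^ card {..<i} * (\<Prod>j<i. \<rho> i - \<rho> j) * (\<Prod>j=Suc i..<degree p. \<rho> i - \<rho> j))"
    by simp
  also have "\<dots> > 0"
    by (intro mult_pos_pos sign_linear_prod) (use assms in \<open>auto simp: descending_negative_roots_def\<close>)
  finally show ?thesis .
qed

lemma poly_sign_at_minus_infinity:
  fixes f :: "real poly"
  assumes "lead_coeff f > 0"
  shows "\<exists>x<b. (-1) ^ degree f * poly f x > 0"
proof -
  define g where "g = smult ((-1) ^ degree f) (f \<circ>\<^sub>p [:0, -1:])"
  have "lead_coeff g = lead_coeff f"
    by (simp add: g_def lead_coeff_comp flip: power_mult_distrib)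
  then obtain n where n: "\<And>x. x \<ge> n \<Longrightarrow> poly g x \<ge> lead_coeff f"
    using poly_pinfty_gt_lc[of g] assms by auto
  let ?x = "max n (1 - b)"
  have "(-1) ^ degree f * poly f (- ?x) = poly g ?x" by (simp add: g_def poly_pcompose)
  also have "\<dots> > 0" using n[of ?x] assms by simp
  finally show ?thesis by (intro exI[of _ "- ?x"]) auto
qed

text \<open>The signs of \<open>f\<close> alternate along \<open>0\<close>, the roots of \<open>p\<close>, and, if \<open>f\<close> has the larger degree, a
  point far to the left. The intermediate value theorem gives a root of \<open>f\<close> in each gap, which
  exhausts its degree. Knowing the gap of each root gives the sign of \<open>p\<close> there.\<close>

lemma interlacing_roots:
  assumes p: "descending_negative_roots p \<rho>" "lead_coeff p > 0"
    and f: "lead_coeff f > 0" "degree f = degree p \<or> degree f = Suc (degree p)" "poly f 0 > 0"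
    and alt: "\<And>i. i < degree p \<Longrightarrow> (-1) ^ i * poly f (\<rho> i) < 0"
  shows "\<exists>\<sigma>. descending_negative_roots f \<sigma> \<and> (\<forall>i<degree f. (-1) ^ i * poly p (\<sigma> i) > 0)"
proof -
  define b where "b = (if degree p = 0 then 0 else \<rho> (degree p - 1))"
  obtain m where m: "m < b" "(-1) ^ degree f * poly f m > 0"
    using poly_sign_at_minus_infinity[OF f(1)] by blast
  \<comment> \<open>The end points of the gaps, from right to left.\<close>
  define \<tau> where "\<tau> i = (if i = 0 then 0 else if i \<le> degree p then \<rho> (i - 1) else m)" for i
  have sgn: "(-1) ^ i * poly f (\<tau> i) > 0" if "i \<le> degree f" for i
  proof (cases i)
    case (Suc j)
    then show ?thesis
      using alt[of j] that f(2) m(2) by (cases "j < degree p") (auto simp: \<tau>_def le_Suc_eq)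
  qed (simp add: \<tau>_def f(3))
  have step: "\<tau> (Suc i) < \<tau> i" if "i < degree f" for i
  proof (cases "i < degree p")
    case True
    then show ?thesis using p(1) by (cases i) (auto simp: \<tau>_def descending_negative_roots_def)
  next
    case False
    then have "i = degree p" using that f(2) by auto
    then show ?thesis using m(1) by (auto simp: \<tau>_def b_def)
  qed
  have "\<exists>s. \<tau> (Suc i) < s \<and> s < \<tau> i \<and> poly f s = 0" if "i < degree f" for i
  proof (rule poly_IVT[OF step[OF that]])
    show "poly f (\<tau> (Suc i)) * poly f (\<tau> i) < 0"
      using sgn[of i] sgn[of "Suc i"] that by (cases "even i") (auto simp: mult_less_0_iff)
  qed
  then obtain \<sigma> where \<sigma>: "\<And>i. i < degree f \<Longrightarrow> \<tau> (Suc i) < \<sigma> i \<and> \<sigma> i < \<tau> i \<and> poly f (\<sigma> i) = 0"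
    by metis
  have mono: "\<tau> j \<le> \<tau> i" if "i \<le> j" "j \<le> degree f" for i j
    using that
  proof (induction j rule: dec_induct)
    case (step k)
    then show ?case using \<open>\<And>i. i < degree f \<Longrightarrow> \<tau> (Suc i) < \<tau> i\<close>[of k] by simp
  qed simp
  have "descending_negative_roots f \<sigma>"
    unfolding descending_negative_roots_def
  proof (intro conjI allI impI)
    fix i assume i: "i < degree f"
    have "\<tau> i \<le> 0" using mono[of 0 i] i by (simp add: \<tau>_def)
    then show "\<sigma> i < 0" "poly f (\<sigma> i) = 0" using \<sigma>[OF i] by auto
  next
    fix i j assume "i < j" "j < degree f"
    then show "\<sigma> j < \<sigma> i" using \<sigma>[of i] \<sigma>[of j] mono[of "Suc i" j] by fastforce
  qed
  moreover have "(-1) ^ i * poly p (\<sigma> i) > 0" if i: "i < degree f" for i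
  proof (rule descending_negative_roots_sign[OF p])
    show "i \<le> degree p" using i f(2) by auto
    show "\<sigma> i < \<rho> j" if "j < i" for j
      using mono[of "Suc j" i] \<sigma>[OF i] that i f(2) by (auto simp: \<tau>_def split: if_splits)
    show "\<rho> j < \<sigma> i" if "i \<le> j" "j < degree p" for j
    proof -
      have "\<tau> (Suc j) \<le> \<tau> (Suc i)" using that i f(2) by (intro mono) auto
      then show ?thesis using \<sigma>[OF i] that by (auto simp: \<tau>_def)
    qed
  qed
  ultimately show ?thesis by blast
qed

section \<open>Roots of the thagomizer polynomials\<close>

declare thag_poly.simps(2) [simp del]

lemma poly_map_poly_of_int_of_real:
  "poly (map_poly of_int p) (of_real x :: complex) = of_real (poly (real_poly p) x)"
  by (simp add: poly_altdef coeff_map_poly)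

text \<open>The passage to \<open>\<complex>\<close>: the embedded real roots exhaust the degree, and the derivative does not vanish
  at them.\<close>

lemma simple_negative_zeros:
  assumes roots: "descending_negative_roots (real_poly p) \<sigma>" and lc: "lead_coeff p > 0"
  shows "card {z :: complex. poly (map_poly of_int p) z = 0} = degree p"
    and "poly (map_poly of_int p) (z :: complex) = 0 \<Longrightarrow>
      z \<in> \<real> \<and> Re z < 0 \<and> order z (map_poly of_int p) = 1"
proof -
  let ?c = "map_poly of_int p :: complex poly" and ?Z = "{z :: complex. poly (map_poly of_int p) z = 0}"
  define S where "S = (\<lambda>i. complex_of_real (\<sigma> i)) ` {..<degree p}"
  have "?c \<noteq> 0" using lc by (metis degree_0 degree_map_poly_of_int coeff_0 coeff_map_poly
        less_irrefl of_int_0 of_int_eq_0_iff)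
  have "S \<subseteq> ?Z"
    using roots by (auto simp: S_def descending_negative_roots_def poly_map_poly_of_int_of_real)
  moreover have cardS: "card S = degree p"
    using descending_negative_roots_inj_on[OF roots] by (simp add: S_def card_image inj_on_def)
  moreover have "card ?Z \<le> degree p" "finite ?Z"
    using card_poly_roots_bound[OF \<open>?c \<noteq> 0\<close>] poly_roots_finite[OF \<open>?c \<noteq> 0\<close>] by auto
  ultimately have Z: "?Z = S" by (metis card_seteq)
  then show "card ?Z = degree p" using cardS by simp
  assume "poly ?c z = 0"
  then obtain i where i: "i < degree p" "z = of_real (\<sigma> i)" using Z by (auto simp: S_def)
  have "lead_coeff (real_poly p) > 0" using lc by (simp add: coeff_map_poly)
  then have "poly (pderiv (real_poly p)) (\<sigma> i) \<noteq> 0"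
    using descending_negative_roots_sign_pderiv[OF roots, of i] i by auto
  then have nz: "poly (pderiv ?c) z \<noteq> 0"
    by (simp add: i map_poly_of_int_pderiv[symmetric] poly_map_poly_of_int_of_real)
  have "order z ?c = 1"
    using order_pderiv[OF \<open>?c \<noteq> 0\<close> \<open>poly ?c z = 0\<close>] order_0I[OF nz] by simp
  then show "z \<in> \<real> \<and> Re z < 0 \<and> order z ?c = 1"
    using i roots by (auto simp: descending_negative_roots_def)
qed

lemma poly_thag_Suc:
  "poly (real_poly (thag_poly (Suc n))) x = (1 - x) * poly (real_poly (thag_poly n)) x + x * poly (real_poly (motzkin n)) x"
  by (simp add: thag_poly.simps map_poly_of_int_simps algebra_simps)

lemma poly_legendre_Suc:
  "poly (real_poly (legendre (Suc n))) x =
     2 * (1 - x) * poly (real_poly (legendre n)) x + (real n + 2) * x * poly (real_poly (motzkin n)) x"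
  unfolding legendre_Suc by (simp add: map_poly_of_int_simps algebra_simps)

lemma poly_motzkin_Suc:
  "(real n + 3) * poly (real_poly (motzkin (Suc n))) x =
     2 * (real n + 1) * poly (real_poly (motzkin n)) x + 2 * poly (real_poly (legendre (Suc n))) x"
proof -
  have "poly (real_poly (smult (int n + 3) (motzkin (Suc n)))) x =
      poly (real_poly (smult (2 * (int n + 1)) (motzkin n) + smult 2 (legendre (Suc n)))) x"
    by (simp only: motzkin_Suc)
  then show ?thesis by (simp add: map_poly_of_int_simps algebra_simps)
qed

lemma poly_thag_ode:
  "(real n + 1) * poly (real_poly (thag_poly n)) x + (1 - x) * poly (pderiv (real_poly (thag_poly n))) x =
     poly (real_poly (legendre n)) x"
proof -
  have "poly (real_poly (smult (int n + 1) (thag_poly n) + [:1, -1:] * pderiv (thag_poly n))) x =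
      poly (real_poly (legendre n)) x"
    by (simp only: thag_ode)
  then show ?thesis by (simp add: map_poly_of_int_simps algebra_simps)
qed

lemma poly_thag_at_0: "poly (real_poly (thag_poly n)) 0 = 1"
  by (simp add: poly_0_coeff_0 coeff_map_poly coeff_thag_0)

lemma lead_coeff_real_thag: "lead_coeff (real_poly (thag_poly n)) > 0"
  using coeff_thag_top[of n] by (simp add: coeff_map_poly degree_thag)

text \<open>The invariant of the induction on \<open>n\<close>. The second inequality says that \<open>motzkin (n - 1)\<close> has the
  sign \<open>(-1) ^ i\<close> as well, by \<open>motzkin_Suc\<close>, but makes sense for \<open>n = 0\<close> too. Together they imply
  that \<open>motzkin n\<close> has this sign and bound \<open>legendre n\<close> by a multiple of \<open>motzkin n\<close>.\<close>

definition aligned_at_roots :: "nat \<Rightarrow> (nat \<Rightarrow> real) \<Rightarrow> bool" where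
  "aligned_at_roots n \<rho> \<longleftrightarrow> descending_negative_roots (real_poly (thag_poly n)) \<rho> \<and>
     (\<forall>i < n div 2. (-1) ^ i * poly (real_poly (legendre n)) (\<rho> i) > 0 \<and>
       (-1) ^ i * ((real n + 2) * poly (real_poly (motzkin n)) (\<rho> i)
         - 2 * poly (real_poly (legendre n)) (\<rho> i)) \<ge> 0)"

lemma thag_interlacing_step:
  assumes al: "aligned_at_roots n \<rho>"
    and f: "lead_coeff f > 0" "degree f = Suc n div 2" "poly f 0 > 0"
    and alt: "\<And>i. i < n div 2 \<Longrightarrow> (-1) ^ i * poly f (\<rho> i) < 0"
  shows "\<exists>\<sigma>. descending_negative_roots f \<sigma> \<and>
    (\<forall>i<Suc n div 2. (-1) ^ i * poly (real_poly (thag_poly n)) (\<sigma> i) > 0)"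
proof -
  have "\<exists>\<sigma>. descending_negative_roots f \<sigma> \<and>
    (\<forall>i<degree f. (-1) ^ i * poly (real_poly (thag_poly n)) (\<sigma> i) > 0)"
  proof (rule interlacing_roots[OF _ lead_coeff_real_thag f(1) _ f(3)])
    show "descending_negative_roots (real_poly (thag_poly n)) \<rho>" using al by (simp add: aligned_at_roots_def)
    show "degree f = degree (real_poly (thag_poly n)) \<or> degree f = Suc (degree (real_poly (thag_poly n)))"
      unfolding f(2) degree_map_poly_of_int degree_thag by linarith
  qed (use alt in \<open>simp add: degree_thag\<close>)
  then show ?thesis by (simp add: f(2))
qed

lemma aligned_motzkin_pos:
  assumes "aligned_at_roots n \<rho>" "i < n div 2"
  shows "(-1) ^ i * poly (real_poly (motzkin n)) (\<rho> i) > 0"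
proof -
  have "(-1) ^ i * ((real n + 2) * poly (real_poly (motzkin n)) (\<rho> i)) > 0"
    using assms unfolding aligned_at_roots_def by (fastforce simp: right_diff_distrib mult.left_commute)
  then have "(real n + 2) * ((-1) ^ i * poly (real_poly (motzkin n)) (\<rho> i)) > 0"
    by (simp only: mult.left_commute)
  then show ?thesis by (simp add: zero_less_mult_iff)
qed

text \<open>At a root \<open>r\<close> of \<open>thag_poly n\<close> the recurrence reads \<open>thag_poly (n + 1) = r * motzkin n\<close>, so the
  signs alternate and the new roots interlace the old ones. At a new root, \<open>thag_ode\<close> makes
  \<open>legendre (n + 1)\<close> a positive multiple of the derivative, and the recurrence makes \<open>motzkin n\<close> a
  positive multiple of \<open>thag_poly n\<close>; both have the required sign.\<close>

lemma aligned_Suc: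
  assumes "aligned_at_roots n \<rho>"
  shows "\<exists>\<sigma>. aligned_at_roots (Suc n) \<sigma>"
proof -
  let ?t = "real_poly (thag_poly n)" and ?t' = "real_poly (thag_poly (Suc n))"
  have \<rho>: "\<rho> i < 0" "poly ?t (\<rho> i) = 0" if "i < n div 2" for i
    using assms that by (auto simp: aligned_at_roots_def descending_negative_roots_def degree_thag)
  have "\<exists>\<sigma>. descending_negative_roots ?t' \<sigma> \<and> (\<forall>i<Suc n div 2. (-1) ^ i * poly ?t (\<sigma> i) > 0)"
  proof (rule thag_interlacing_step[OF assms lead_coeff_real_thag])
    fix i assume i: "i < n div 2"
    have eq: "(-1) ^ i * poly ?t' (\<rho> i) = \<rho> i * ((-1) ^ i * poly (real_poly (motzkin n)) (\<rho> i))"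
      unfolding poly_thag_Suc \<rho>(2)[OF i] by (simp add: algebra_simps)
    show "(-1) ^ i * poly ?t' (\<rho> i) < 0"
      unfolding eq by (rule mult_neg_pos[OF \<rho>(1)[OF i] aligned_motzkin_pos[OF assms i]])
  qed (simp_all add: degree_thag poly_thag_at_0)
  then obtain \<sigma> where \<sigma>: "descending_negative_roots ?t' \<sigma>"
      "\<And>i. i < Suc n div 2 \<Longrightarrow> (-1) ^ i * poly ?t (\<sigma> i) > 0"
    by blast
  have "aligned_at_roots (Suc n) \<sigma>"
    unfolding aligned_at_roots_def
  proof (intro conjI allI impI \<sigma>(1))
    fix i assume i: "i < Suc n div 2"
    have s: "\<sigma> i < 0" "poly ?t' (\<sigma> i) = 0"
      using \<sigma>(1) i by (auto simp: descending_negative_roots_def degree_thag)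
    have leg: "poly (real_poly (legendre (Suc n))) (\<sigma> i) = (1 - \<sigma> i) * poly (pderiv ?t') (\<sigma> i)"
      using poly_thag_ode[of "Suc n" "\<sigma> i"] s by simp
    have "(-1) ^ i * poly (pderiv ?t') (\<sigma> i) > 0"
      using descending_negative_roots_sign_pderiv[OF \<sigma>(1) lead_coeff_real_thag, of i] i
      by (simp add: degree_thag)
    then have "(1 - \<sigma> i) * ((-1) ^ i * poly (pderiv ?t') (\<sigma> i)) > 0"
      by (rule mult_pos_pos[rotated]) (use s in simp)
    then show "(-1) ^ i * poly (real_poly (legendre (Suc n))) (\<sigma> i) > 0"
      unfolding leg by (simp only: mult.left_commute)
    have "- \<sigma> i * poly (real_poly (motzkin n)) (\<sigma> i) = (1 - \<sigma> i) * poly ?t (\<sigma> i)"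
      using s poly_thag_Suc[of n "\<sigma> i"] by simp
    then have "- \<sigma> i * ((-1) ^ i * poly (real_poly (motzkin n)) (\<sigma> i)) =
        (1 - \<sigma> i) * ((-1) ^ i * poly ?t (\<sigma> i))"
      by (metis mult.left_commute)
    also have "\<dots> > 0" by (rule mult_pos_pos[OF _ \<sigma>(2)[OF i]]) (use s in simp)
    finally have "(-1) ^ i * poly (real_poly (motzkin n)) (\<sigma> i) > 0"
      by (rule zero_less_mult_pos) (use s in simp)
    then have "2 * (real n + 1) * ((-1) ^ i * poly (real_poly (motzkin n)) (\<sigma> i)) \<ge> 0"
      by simp
    moreover have "(real (Suc n) + 2) * poly (real_poly (motzkin (Suc n))) (\<sigma> i) -
        2 * poly (real_poly (legendre (Suc n))) (\<sigma> i) =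
        2 * (real n + 1) * poly (real_poly (motzkin n)) (\<sigma> i)"
      using poly_motzkin_Suc[of n "\<sigma> i"] by (simp add: algebra_simps)
    ultimately show "(-1) ^ i * ((real (Suc n) + 2) * poly (real_poly (motzkin (Suc n))) (\<sigma> i) -
        2 * poly (real_poly (legendre (Suc n))) (\<sigma> i)) \<ge> 0"
      by (metis mult.left_commute)
  qed
  then show ?thesis by blast
qed

lemma ex_aligned_at_roots: "\<exists>\<rho>. aligned_at_roots n \<rho>"
proof (induction n)
  case 0
  show ?case by (auto simp: aligned_at_roots_def descending_negative_roots_def)
qed (use aligned_Suc in blast)

text \<open>Up to scaling and an index shift, the function
  \<open>P\<^sub>m(z)\<^sup>2 + (1 - z\<^sup>2) * P\<^sub>m'(z)\<^sup>2 / (m * (m + 1))\<close> that Sonin's theorem attaches to the Legendre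
  equation, with \<open>m = n + 1\<close>. It measures the amplitude of the oscillation.\<close>

definition energy :: "nat \<Rightarrow> real \<Rightarrow> real" where
  "energy n x = (poly (real_poly (legendre (Suc n))) x)\<^sup>2 -
     x * (real n + 1) * (real n + 2) * (poly (real_poly (motzkin n)) x)\<^sup>2"

text \<open>Both sides are quadratic forms in \<open>p = legendre (n + 1)\<close> and \<open>v = 2 * (n + 1) * motzkin n\<close>. Their
  difference is positive semidefinite: its diagonal coefficients are at least \<open>2\<close> and \<open>x\<^sup>2 / 4\<close>, and
  its mixed coefficient is at most \<open>\<bar>x\<bar>\<close> in absolute value.\<close>

lemma energy_Suc:
  assumes "n \<ge> 1" "x \<le> 0"
  shows "energy (Suc n) x \<ge> 2 * (1 - x) * energy n x"
proof -
  define X p v m where "X = - x" "p = poly (real_poly (legendre (Suc n))) x"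
    "v = 2 * (real n + 1) * poly (real_poly (motzkin n)) x" "m = real n"
  have m: "m \<ge> 1" "X \<ge> 0" using assms by (auto simp: X_p_v_m_def)
  have E: "energy n x = p\<^sup>2 + X * (m + 2) / (4 * (m + 1)) * v\<^sup>2"
  proof -
    have "(m + 1) * (m + 2) * (poly (real_poly (motzkin n)) x)\<^sup>2 = (m + 2) / (4 * (m + 1)) * v\<^sup>2"
      using m by (simp add: X_p_v_m_def(3) X_p_v_m_def(4)[symmetric] field_simps power2_eq_square)
    then show ?thesis unfolding energy_def X_p_v_m_def[symmetric]
      by (simp add: X_p_v_m_def(1) mult.assoc)
  qed
  have M: "(m + 3) * poly (real_poly (motzkin (Suc n))) x = v + 2 * p"
    using poly_motzkin_Suc[of n x] by (simp add: X_p_v_m_def)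
  have L: "poly (real_poly (legendre (Suc (Suc n)))) x = 2 * p - X * v"
  proof -
    have "(real (Suc n) + 2) * x * poly (real_poly (motzkin (Suc n))) x = - X * (v + 2 * p)"
      unfolding M[symmetric] by (simp add: X_p_v_m_def(1,4))
    then show ?thesis
      unfolding poly_legendre_Suc[of "Suc n" x] X_p_v_m_def(2)[symmetric]
      by (simp add: X_p_v_m_def(1) algebra_simps)
  qed
  have E': "energy (Suc n) x = (2 * p - X * v)\<^sup>2 + X * (m + 2) / (m + 3) * (v + 2 * p)\<^sup>2"
    unfolding energy_def L M[symmetric] using m
    by (simp add: X_p_v_m_def(1,4) field_simps power2_eq_square)
  define A B where "A = (m + 2) / (m + 3)" "B = (m + 2) / (4 * (m + 1))"
  define \<alpha> \<beta> \<gamma> where "\<alpha> = 2 + X * (4 * A - 2)" "\<beta> = 2 * X * (1 - A)"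
    "\<gamma> = X\<^sup>2 * (1 - 2 * B) + X * (A - 2 * B)"
  have "energy (Suc n) x - 2 * (1 - x) * energy n x =
      (2 * p - X * v)\<^sup>2 + X * A * (v + 2 * p)\<^sup>2 - 2 * (1 + X) * (p\<^sup>2 + X * B * v\<^sup>2)"
    unfolding E E' by (simp add: A_B_def X_p_v_m_def(1))
  also have "\<dots> = \<alpha> * p\<^sup>2 - 2 * (\<beta> * p * v) + \<gamma> * v\<^sup>2"
    unfolding \<alpha>_\<beta>_\<gamma>_def by (simp add: power2_eq_square algebra_simps)
  also have "\<dots> \<ge> 0"
  proof -
    have A: "A \<ge> 3 / 4" "A \<le> 1" using m by (auto simp: A_B_def field_simps)
    have B: "B \<le> 3 / 8" using m by (auto simp: A_B_def field_simps)
    have "(m + 2) / (2 * (m + 1)) \<le> (m + 2) / (m + 3)" using m by (intro divide_left_mono) auto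
    moreover have "2 * B = (m + 2) / (2 * (m + 1))" using m by (simp add: A_B_def field_simps)
    ultimately have AB: "A \<ge> 2 * B" by (simp add: A_B_def)
    have a: "\<alpha> \<ge> 2" using A m by (simp add: \<alpha>_\<beta>_\<gamma>_def)
    have "X\<^sup>2 * (1 / 4) \<le> X\<^sup>2 * (1 - 2 * B)" using B by (intro mult_left_mono) auto
    moreover have "X * (A - 2 * B) \<ge> 0" using AB m by simp
    ultimately have g: "\<gamma> \<ge> X\<^sup>2 / 4" by (simp add: \<alpha>_\<beta>_\<gamma>_def)
    have "2 * X * (1 - A) \<le> 2 * X * (1 / 4)" using A m by (intro mult_left_mono) auto
    then have b: "0 \<le> \<beta>" "\<beta> \<le> X / 2" using m A by (auto simp: \<alpha>_\<beta>_\<gamma>_def)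
    have "\<beta> * p * v \<le> X / 2 * \<bar>p * v\<bar>"
    proof -
      have "\<beta> * (p * v) \<le> \<beta> * \<bar>p * v\<bar>" using b by (intro mult_left_mono) auto
      also have "\<dots> \<le> X / 2 * \<bar>p * v\<bar>" using b by (intro mult_right_mono) auto
      finally show ?thesis by (simp add: mult.assoc)
    qed
    moreover have "2 * p\<^sup>2 + X\<^sup>2 / 4 * v\<^sup>2 - X * \<bar>p * v\<bar> \<ge> 0"
    proof -
      have "(\<bar>p\<bar> - X / 2 * \<bar>v\<bar>)\<^sup>2 \<ge> 0" by simp
      then have "p\<^sup>2 + X\<^sup>2 / 4 * v\<^sup>2 - X * \<bar>p * v\<bar> \<ge> 0"
        by (simp add: power2_diff abs_mult power_mult_distrib power_divide algebra_simps)
      then show ?thesis by (smt (verit) zero_le_power2)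
    qed
    moreover have "\<alpha> * p\<^sup>2 \<ge> 2 * p\<^sup>2" "\<gamma> * v\<^sup>2 \<ge> X\<^sup>2 / 4 * v\<^sup>2"
      using mult_right_mono[OF a zero_le_power2[of p]] mult_right_mono[OF g zero_le_power2[of v]]
      by simp_all
    ultimately show ?thesis by linarith
  qed
  finally show ?thesis by simp
qed

lemma energy_2: assumes "x \<le> 0" shows "energy 2 x \<ge> 12 * (1 - x) ^ 3"
proof -
  have "legendre 3 = [:8, 12:]" by (simp add: legendre_def motzkin_2_3 pderiv_pCons)
  then have "legendre (Suc 2) = [:8, 12:]" by simp
  then have "energy 2 x - 12 * (1 - x) ^ 3 = 12 * (x + 3 / 2)\<^sup>2 + 25"
    by (simp add: energy_def motzkin_2_3 map_poly_pCons power2_eq_square power3_eq_cube algebra_simps)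
  also have "\<dots> \<ge> 0" by simp
  finally show ?thesis by simp
qed

text \<open>The constant \<open>12\<close> is the leading coefficient of \<open>energy 2\<close> as a polynomial in \<open>-x\<close>. Any
  constant greater than \<open>9\<close> would let the bound exceed \<open>(n + 2)\<^sup>2\<close> from \<open>n = 4\<close> on.\<close>

lemma energy_lower_bound:
  assumes "x \<le> 0"
  shows "energy (n + 2) x \<ge> 12 * (1 - x) ^ 3 * (2 * (1 - x)) ^ n"
proof (induction n)
  case 0
  then show ?case using energy_2[OF assms] by (simp add: numeral_2_eq_2)
next
  case (Suc n)
  have "12 * (1 - x) ^ 3 * (2 * (1 - x)) ^ Suc n \<le> 2 * (1 - x) * energy (n + 2) x"
    using mult_left_mono[OF Suc, of "2 * (1 - x)"] assms by (simp add: algebra_simps)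
  also have "\<dots> \<le> energy (Suc (n + 2)) x" by (rule energy_Suc) (use assms in auto)
  finally show ?case by simp
qed

text \<open>At a root \<open>r\<close> of \<open>thag_poly n\<close> the values \<open>N\<close> of \<open>motzkin n\<close> and \<open>p\<close> of \<open>legendre n\<close> have the same
  sign and \<open>2 * \<bar>p\<bar> \<le> (n + 2) * \<bar>N\<bar>\<close>, so the energy is at most \<open>(1 - r)\<^sup>2 * (n + 2)\<^sup>2 * N\<^sup>2\<close>. For
  \<open>n \<ge> 4\<close> the lower bound on the energy exceeds \<open>(1 - r)\<^sup>2 * (n + 2)\<^sup>2\<close>. The only root for \<open>n = 2\<close>
  is \<open>-1\<close> and for \<open>n = 3\<close> it is \<open>-1 / 4\<close>.\<close>

lemma abs_motzkin_gt_1: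
  assumes al: "aligned_at_roots n \<rho>" and i: "i < n div 2"
  shows "\<bar>poly (real_poly (motzkin n)) (\<rho> i)\<bar> > 1"
proof -
  define r where "r = \<rho> i"
  have r: "r < 0" "poly (real_poly (thag_poly n)) r = 0"
    using al i by (auto simp: aligned_at_roots_def descending_negative_roots_def degree_thag r_def)
  consider "n = 2" | "n = 3" | "n \<ge> 4" using i by linarith
  then have "\<bar>poly (real_poly (motzkin n)) r\<bar> > 1"
  proof cases
    case 1
    have "r = -1" using r 1 by (simp add: thag_2_3 map_poly_pCons)
    then show ?thesis using 1 by (simp add: motzkin_2_3 map_poly_pCons)
  next
    case 2
    have "r = -1/4" using r 2 by (simp add: thag_2_3 map_poly_pCons field_simps)
    then show ?thesis using 2 by (simp add: motzkin_2_3 map_poly_pCons)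
  next
    case 3
    define N p X where "N = (-1) ^ i * poly (real_poly (motzkin n)) r"
      "p = (-1) ^ i * poly (real_poly (legendre n)) r" "X = - r"
    have p: "p > 0" "2 * p \<le> (real n + 2) * N"
      using al i by (auto simp: N_p_X_def r_def aligned_at_roots_def algebra_simps)
    have X: "X > 0" using r by (simp add: N_p_X_def)
    define m where "m = (real n + 2) * N"
    have N0: "N > 0" using p by (smt (verit) mult_le_0_iff of_nat_0_le_iff)
    have m0: "m > 0" using N0 by (simp add: m_def)
    have sq: "((-1) ^ i)\<^sup>2 = (1::real)" by (simp flip: power_mult)
    have "energy n r = (2 * (1 + X) * p - X * m)\<^sup>2 + X * (real n + 1) * (real n + 2) * N\<^sup>2"
    proof -
      have "poly (real_poly (legendre (Suc n))) r = (-1) ^ i * (2 * (1 + X) * p - X * m)"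
        unfolding poly_legendre_Suc N_p_X_def m_def using sq
        by (simp add: power2_eq_square algebra_simps)
      moreover have "poly (real_poly (motzkin n)) r = (-1) ^ i * N"
        unfolding N_p_X_def using sq by (simp add: power2_eq_square flip: mult.assoc)
      ultimately show ?thesis
        unfolding energy_def by (simp add: power_mult_distrib sq N_p_X_def(3))
    qed
    moreover have "(2 * (1 + X) * p - X * m)\<^sup>2 \<le> (1 + X\<^sup>2) * m\<^sup>2"
    proof -
      have "2 * p * (1 + X) \<le> m * (1 + X)"
        using p X by (intro mult_right_mono) (auto simp: m_def)
      then have "2 * (1 + X) * p - X * m \<le> m" by (simp add: algebra_simps)
      moreover have "- (X * m) \<le> 2 * (1 + X) * p - X * m" using p X by simp
      ultimately have "\<bar>2 * (1 + X) * p - X * m\<bar> \<le> max m (X * m)" by linarith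
      then have "(2 * (1 + X) * p - X * m)\<^sup>2 \<le> (max m (X * m))\<^sup>2"
        by (metis abs_ge_zero power2_abs power_mono)
      also have "\<dots> \<le> m\<^sup>2 + (X * m)\<^sup>2" by (auto simp: max_def)
      finally show ?thesis by (simp add: algebra_simps power_mult_distrib)
    qed
    moreover have "X * (real n + 1) * (real n + 2) * N\<^sup>2 \<le> 2 * X * m\<^sup>2"
    proof -
      have "(real n + 1) * (real n + 2) * (X * N\<^sup>2) \<le> 2 * (real n + 2)\<^sup>2 * (X * N\<^sup>2)"
        using X by (intro mult_right_mono) (simp_all add: power2_eq_square[of "real n + 2"] algebra_simps)
      moreover have "X * (real n + 1) * (real n + 2) * N\<^sup>2 = (real n + 1) * (real n + 2) * (X * N\<^sup>2)"
        by simp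
      moreover have "2 * X * m\<^sup>2 = 2 * (real n + 2)\<^sup>2 * (X * N\<^sup>2)"
        unfolding m_def power_mult_distrib by simp
      ultimately show ?thesis by (simp only:)
    qed
    ultimately have up: "energy n r \<le> (1 + X)\<^sup>2 * m\<^sup>2"
      by (simp add: power2_eq_square algebra_simps)
    define k where "k = n - 2"
    have k: "n = k + 2" "k \<ge> 2" using 3 by (auto simp: k_def)
    have pow: "12 * 2 ^ k > (real n + 2)\<^sup>2"
    proof -
      have "12 * 2 ^ k > (real k + 4)\<^sup>2" using k(2)
      proof (induction k rule: dec_induct)
        case (step j)
        have "(real (Suc j) + 4)\<^sup>2 \<le> 2 * (real j + 4)\<^sup>2" by (simp add: power2_eq_square algebra_simps)
        then show ?case using step by simp
      qed simp
      then show ?thesis by (simp add: k add.commute)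
    qed
    have "(1 + X)\<^sup>2 * (real n + 2)\<^sup>2 < (1 + X)\<^sup>2 * (12 * 2 ^ k)"
      using pow X by (intro mult_strict_left_mono) auto
    also have "\<dots> \<le> (1 + X)\<^sup>2 * (12 * 2 ^ k) * (1 + X) ^ (k + 1)"
    proof -
      have "1 \<le> (1 + X) ^ (k + 1)" using X by (intro one_le_power) simp
      then show ?thesis
        using mult_left_mono[of 1 "(1 + X) ^ (k + 1)" "(1 + X)\<^sup>2 * (12 * 2 ^ k)"] by simp
    qed
    also have "\<dots> = 12 * (1 - r) ^ 3 * (2 * (1 - r)) ^ k"
      by (simp add: N_p_X_def power_mult_distrib power3_eq_cube power2_eq_square
          del: right_diff_distrib_numeral)
    also have "\<dots> \<le> energy n r" using energy_lower_bound[of r k] r k by simp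
    also note up
    finally have "(real n + 2)\<^sup>2 < m\<^sup>2" using X by (simp add: mult_less_cancel_left)
    then have "(real n + 2)\<^sup>2 * 1 < (real n + 2)\<^sup>2 * N\<^sup>2" by (simp add: m_def power_mult_distrib)
    then have "1 < N\<^sup>2" by (subst (asm) mult_less_cancel_left_pos) auto
    then have "\<bar>N\<bar> > 1" by (metis abs_square_le_1 not_le)
    then show ?thesis by (simp add: N_p_X_def abs_mult)
  qed
  then show ?thesis by (simp add: r_def)
qed

lemma thag_roots:
  shows "\<exists>\<sigma>. descending_negative_roots (real_poly (thag_poly n)) \<sigma>"
  using ex_aligned_at_roots[of n] by (auto simp: aligned_at_roots_def)

lemma thag_plus_X_top:
  assumes "n \<ge> 2"
  shows "degree (thag_poly n + [:0, 1:]) = n div 2" "lead_coeff (thag_poly n + [:0, 1:]) > 0"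
proof -
  have pos: "coeff (thag_poly n + [:0, 1:]) (n div 2) > 0"
    using coeff_thag_top[of n] by (simp add: coeff_pCons add_pos_nonneg split: nat.split)
  have "degree (thag_poly n + [:0, 1:]) \<le> n div 2"
    using degree_thag_le[of n] assms by (intro degree_add_le) auto
  with pos show d: "degree (thag_poly n + [:0, 1:]) = n div 2"
    by (intro antisym le_degree) auto
  show "lead_coeff (thag_poly n + [:0, 1:]) > 0" using pos unfolding d .
qed

text \<open>The same interlacing as for \<open>thag_poly n\<close>: at a root \<open>r\<close> of \<open>thag_poly (n - 1)\<close> the value is
  \<open>r * (motzkin (n - 1) + 1)\<close>, and the summand \<open>1\<close> does not change the sign of \<open>motzkin (n - 1)\<close>.\<close>

lemma thag_plus_X_roots:
  assumes "n \<ge> 2"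
  shows "\<exists>\<sigma>. descending_negative_roots (real_poly (thag_poly n + [:0, 1:])) \<sigma>"
proof -
  obtain m where m: "n = Suc m" using assms by (cases n) auto
  obtain \<rho> where al: "aligned_at_roots m \<rho>" using ex_aligned_at_roots by blast
  let ?f = "real_poly (thag_poly n + [:0, 1:])"
  have f: "poly ?f x = poly (real_poly (thag_poly n)) x + x" for x
    by (simp add: map_poly_of_int_simps)
  have "\<exists>\<sigma>. descending_negative_roots ?f \<sigma> \<and>
    (\<forall>i<Suc m div 2. (-1) ^ i * poly (real_poly (thag_poly m)) (\<sigma> i) > 0)"
  proof (rule thag_interlacing_step[OF al])
    show "lead_coeff ?f > 0" using thag_plus_X_top[OF assms] by (simp add: coeff_map_poly)
    show "degree ?f = Suc m div 2"
      using thag_plus_X_top(1)[OF assms] m by simp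
    show "poly ?f 0 > 0" by (simp add: f poly_thag_at_0)
    fix i assume i: "i < m div 2"
    have r: "\<rho> i < 0" "poly (real_poly (thag_poly m)) (\<rho> i) = 0"
      using al i by (auto simp: aligned_at_roots_def descending_negative_roots_def degree_thag)
    have "(-1) ^ i * (poly (real_poly (motzkin m)) (\<rho> i) + 1) > 0"
      using aligned_motzkin_pos[OF al i] abs_motzkin_gt_1[OF al i]
      by (cases "even i") auto
    moreover have "(-1) ^ i * poly ?f (\<rho> i) =
        \<rho> i * ((-1) ^ i * (poly (real_poly (motzkin m)) (\<rho> i) + 1))"
      unfolding f unfolding m poly_thag_Suc r(2) by (simp add: algebra_simps)
    ultimately show "(-1) ^ i * poly ?f (\<rho> i) < 0"
      using mult_neg_pos[OF r(1)] by metis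
  qed
  then show ?thesis by blast
qed

section \<open>Minors and flats of a matroid\<close>

locale matroid =
  fixes M :: "'a matroid"
  assumes matroid: "is_matroid M"
begin

abbreviation E where "E \<equiv> ground M"
abbreviation r where "r \<equiv> rank_of M"

lemma finite_ground: "finite E"
  using matroid by (simp add: is_matroid_def)

lemma indep_subset: "I \<in> indeps M \<Longrightarrow> I \<subseteq> E"
  using matroid by (auto simp: is_matroid_def)

lemma indep_finite: "I \<in> indeps M \<Longrightarrow> finite I"
  using indep_subset finite_ground finite_subset by blast

lemma empty_indep: "{} \<in> indeps M"
  using matroid by (simp add: is_matroid_def)

lemma indep_mono: "I \<in> indeps M \<Longrightarrow> J \<subseteq> I \<Longrightarrow> J \<in> indeps M"
  using matroid by (auto simp: is_matroid_def)

lemma indep_exchange: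
  "I \<in> indeps M \<Longrightarrow> J \<in> indeps M \<Longrightarrow> card I < card J \<Longrightarrow> \<exists>e\<in>J - I. insert e I \<in> indeps M"
  using matroid unfolding is_matroid_def by blast

lemma finite_indeps_in: "finite {I \<in> indeps M. I \<subseteq> X}"
proof (rule finite_subset)
  show "{I \<in> indeps M. I \<subseteq> X} \<subseteq> Pow E" using indep_subset by auto
qed (simp add: finite_ground)

lemma card_le_rank: "I \<in> indeps M \<Longrightarrow> I \<subseteq> X \<Longrightarrow> card I \<le> r X"
  unfolding rank_of_def using finite_indeps_in by (intro Max_ge) auto

lemma rank_attained: "\<exists>I\<in>indeps M. I \<subseteq> X \<and> card I = r X"
proof -
  have "r X \<in> card ` {I \<in> indeps M. I \<subseteq> X}"
    unfolding rank_of_def by (rule Max_in) (use finite_indeps_in empty_indep in auto)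
  then show ?thesis by auto
qed

lemma rank_mono: "X \<subseteq> Y \<Longrightarrow> r X \<le> r Y"
  using rank_attained[of X] card_le_rank by (metis order.trans)

lemma rank_le_card: "finite X \<Longrightarrow> r X \<le> card X"
  using rank_attained[of X] by (metis card_mono)

lemma rank_empty [simp]: "r {} = 0"
  using rank_le_card[of "{}"] by simp

lemma rank_indep: "I \<in> indeps M \<Longrightarrow> r I = card I"
  using card_le_rank[of I I] rank_le_card[of I] indep_finite[of I] by simp

lemma indep_if_rank: "finite X \<Longrightarrow> r X = card X \<Longrightarrow> X \<in> indeps M"
  using rank_attained[of X] by (metis card_subset_eq)

lemma rank_union_le: "r (X \<union> Y) \<le> r X + r Y"
proof -
  obtain I where I: "I \<in> indeps M" "I \<subseteq> X \<union> Y" "card I = r (X \<union> Y)"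
    using rank_attained by blast
  have "card I \<le> card (I \<inter> X) + card (I \<inter> Y)"
    using I(2) by (metis card_Un_le Int_Un_distrib Int_absorb2)
  also have "\<dots> \<le> r X + r Y"
    by (intro add_mono card_le_rank) (use I(1) indep_mono in auto)
  finally show ?thesis using I by simp
qed

lemma basis_card: "is_basis_of M X B \<Longrightarrow> card B = r X"
  using rank_attained[of X] card_le_rank[of B X] indep_exchange[of B]
  unfolding is_basis_of_def by (metis DiffD1 DiffD2 DiffI antisym_conv1 le_neq_implies_less subsetD)

lemma basis_extend:
  assumes "I \<in> indeps M" "I \<subseteq> X"
  obtains B where "is_basis_of M X B" "I \<subseteq> B"
proof -
  let ?S = "{J \<in> indeps M. I \<subseteq> J \<and> J \<subseteq> X}"
  have "finite ?S" by (rule finite_subset[OF _ finite_indeps_in[of X]]) auto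
  moreover have "?S \<noteq> {}" using assms by auto
  ultimately have max: "Max (card ` ?S) \<in> card ` ?S" "\<And>J. J \<in> ?S \<Longrightarrow> card J \<le> Max (card ` ?S)"
    by (auto intro!: Max_in)
  from max(1) obtain B where B: "B \<in> ?S" "card B = Max (card ` ?S)" by force
  have "is_basis_of M X B"
    unfolding is_basis_of_def
  proof (intro conjI ballI notI)
    fix e assume "e \<in> X - B" "insert e B \<in> indeps M"
    then have "card (insert e B) \<le> card B" unfolding B(2) using B(1) by (intro max(2)) auto
    then show False using \<open>e \<in> X - B\<close> B(1) indep_finite[of B] by simp
  qed (use B in auto)
  then show ?thesis using that B by auto
qed

lemma ex_basis: "\<exists>B. is_basis_of M X B"
  using basis_extend[OF empty_indep, of X] by auto

lemma finite_subset_ground: "X \<subseteq> E \<Longrightarrow> finite X"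
  using finite_ground finite_subset by blast

text \<open>The right-hand side does not mention \<open>B\<close>: independence in the contraction does not depend on the
  chosen basis of \<open>F\<close>.\<close>

lemma indep_contraction_iff_rank:
  assumes F: "F \<subseteq> E" and B: "is_basis_of M F B" and I: "I \<subseteq> E - F"
  shows "I \<union> B \<in> indeps M \<longleftrightarrow> r (I \<union> F) = card I + r F"
proof
  have fin: "finite I" "finite B" "I \<inter> B = {}"
    using I B indep_finite finite_subset_ground[of I] by (auto simp: is_basis_of_def)
  assume "I \<union> B \<in> indeps M"
  then have "card (I \<union> B) \<le> r (I \<union> F)"
    using B by (intro card_le_rank) (auto simp: is_basis_of_def)
  moreover have "card (I \<union> B) = card I + r F"
    using fin basis_card[OF B] by (simp add: card_Un_disjoint)
  moreover have "r (I \<union> F) \<le> card I + r F"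
    using rank_union_le[of I F] rank_le_card[OF fin(1)] by linarith
  ultimately show "r (I \<union> F) = card I + r F" by linarith
next
  assume eq: "r (I \<union> F) = card I + r F"
  have "B \<in> indeps M" "B \<subseteq> I \<union> F" using B by (auto simp: is_basis_of_def)
  then obtain B' where B': "is_basis_of M (I \<union> F) B'" "B \<subseteq> B'" by (rule basis_extend)
  have ind: "B' \<in> indeps M" "B' \<subseteq> I \<union> F" using B' by (auto simp: is_basis_of_def)
  have "card (B' \<inter> F) \<le> r F" by (rule card_le_rank) (use ind indep_mono in auto)
  moreover have "B \<subseteq> B' \<inter> F" using B B' by (auto simp: is_basis_of_def)
  ultimately have BF: "B' \<inter> F = B"
    using basis_card[OF B] indep_finite[OF ind(1)] by (metis card_seteq finite_Int)
  have "card B' = card (B' - F) + card (B' \<inter> F)"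
    using indep_finite[OF ind(1)] by (metis add.commute card_Int_Diff)
  then have "card I \<le> card (B' - F)"
    using basis_card[OF B'(1)] eq BF basis_card[OF B] by simp
  then have "B' - F = I"
    using ind(2) I finite_subset_ground[of I] by (intro card_seteq) auto
  then show "I \<union> B \<in> indeps M" using BF ind(1) by (metis Un_Diff_Int)
qed

lemma indeps_contraction:
  assumes F: "F \<subseteq> E" and B: "is_basis_of M F B"
  shows "indeps (contraction M F) = {I. I \<subseteq> E - F \<and> I \<union> B \<in> indeps M}"
  using indep_contraction_iff_rank[OF F] B by (auto simp: contraction_def)

lemma ground_contraction [simp]: "ground (contraction M F) = E - F"
  by (simp add: contraction_def)

lemma matroid_contraction:
  assumes F: "F \<subseteq> E"
  shows "is_matroid (contraction M F)"
proof -
  obtain B where B: "is_basis_of M F B" using ex_basis by blast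
  note ind = indeps_contraction[OF F B]
  have BF: "B \<subseteq> F" "B \<in> indeps M" using B by (auto simp: is_basis_of_def)
  have card: "card (I \<union> B) = card I + card B" if "I \<union> B \<in> indeps M" "I \<subseteq> E - F" for I
    using that BF indep_finite[OF that(1)] by (intro card_Un_disjoint) auto
  show ?thesis
    unfolding is_matroid_def ground_contraction ind
  proof (intro conjI ballI allI impI)
    fix I J assume I: "I \<in> {I. I \<subseteq> E - F \<and> I \<union> B \<in> indeps M}"
      and J: "J \<in> {I. I \<subseteq> E - F \<and> I \<union> B \<in> indeps M}" and "card I < card J"
    then have "card (I \<union> B) < card (J \<union> B)" using card by auto
    then obtain e where "e \<in> (J \<union> B) - (I \<union> B)" "insert e (I \<union> B) \<in> indeps M"
      using indep_exchange I J by blast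
    then show "\<exists>e\<in>J - I. insert e I \<in> {I. I \<subseteq> E - F \<and> I \<union> B \<in> indeps M}"
      using I J by (intro bexI[of _ e]) auto
  next
    fix I J assume "I \<in> {I. I \<subseteq> E - F \<and> I \<union> B \<in> indeps M}" "J \<subseteq> I"
    then show "J \<in> {I. I \<subseteq> E - F \<and> I \<union> B \<in> indeps M}"
      using indep_mono[of "I \<union> B" "J \<union> B"] by auto
  qed (use BF finite_ground in auto)
qed

text \<open>Stated as a sum to avoid truncated subtraction.\<close>

lemma rank_contraction:
  assumes F: "F \<subseteq> E" and X: "X \<subseteq> E - F"
  shows "rank_of (contraction M F) X + r F = r (X \<union> F)"
proof -
  interpret C: matroid "contraction M F"
    by unfold_locales (rule matroid_contraction[OF F])
  obtain B where B: "is_basis_of M F B" using ex_basis by blast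
  note ind = indeps_contraction[OF F B]
  have BF: "B \<subseteq> F" "B \<in> indeps M" using B by (auto simp: is_basis_of_def)
  obtain I where I: "I \<in> indeps (contraction M F)" "I \<subseteq> X" "card I = C.r X"
    using C.rank_attained by blast
  have "r (I \<union> F) = card I + r F"
    using I(1) ind indep_contraction_iff_rank[OF F B] by auto
  moreover have "r (I \<union> F) \<le> r (X \<union> F)" by (rule rank_mono) (use I in auto)
  ultimately have 1: "C.r X + r F \<le> r (X \<union> F)" using I by simp
  obtain B' where B': "is_basis_of M (X \<union> F) B'" "B \<subseteq> B'"
    using basis_extend[of B "X \<union> F"] BF by auto
  have ind': "B' \<in> indeps M" "B' \<subseteq> X \<union> F" using B' by (auto simp: is_basis_of_def)
  have "(B' - F) \<union> B \<in> indeps M" by (rule indep_mono[OF ind'(1)]) (use B' in auto)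
  then have "B' - F \<in> indeps (contraction M F)" using ind' X unfolding ind by auto
  then have "card (B' - F) \<le> C.r X" using ind' by (intro C.card_le_rank) auto
  moreover have "card (B' \<inter> F) \<le> r F" by (rule card_le_rank) (use ind' indep_mono in auto)
  moreover have "card B' = card (B' - F) + card (B' \<inter> F)"
    using indep_finite[OF ind'(1)] by (metis add.commute card_Int_Diff)
  ultimately show ?thesis using 1 basis_card[OF B'(1)] by linarith
qed

lemma rk_contraction: "F \<subseteq> E \<Longrightarrow> rk (contraction M F) = rk M - r F"
  using rank_contraction[of F "E - F"] unfolding rk_def ground_contraction
  by (simp add: Un_absorb2)

lemma rank_le_rk: "X \<subseteq> E \<Longrightarrow> r X \<le> rk M"
  unfolding rk_def by (rule rank_mono)

text \<open>Equality of matroids is reduced to their rank functions, which behave well under iterated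
  contraction, whereas the independent sets of a contraction involve a choice of basis.\<close>

lemma matroid_eqI:
  assumes "is_matroid N" "ground N = E" "\<And>X. X \<subseteq> E \<Longrightarrow> rank_of N X = r X"
  shows "N = M"
proof -
  interpret N: matroid N by unfold_locales (rule assms(1))
  have "I \<in> indeps N \<longleftrightarrow> I \<in> indeps M" if I: "I \<subseteq> E" for I
  proof -
    have "I \<in> indeps N \<longleftrightarrow> N.r I = card I"
      using N.rank_indep N.indep_if_rank[OF finite_subset_ground[OF I]] by blast
    also have "\<dots> \<longleftrightarrow> I \<in> indeps M"
      using rank_indep indep_if_rank[OF finite_subset_ground[OF I]] assms(3)[OF I] by metis
    finally show ?thesis .
  qed
  moreover have "indeps N \<subseteq> Pow E" "indeps M \<subseteq> Pow E"
    using indep_subset N.indep_subset assms(2) by blast+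
  ultimately have "indeps N = indeps M" by blast
  then show ?thesis using assms(2) by (simp add: matroid.expand)
qed

lemma contraction_empty: "contraction M {} = M"
proof (rule matroid_eqI)
  show "is_matroid (contraction M {})" by (rule matroid_contraction) simp
  show "rank_of (contraction M {}) X = r X" if "X \<subseteq> E" for X
    using rank_contraction[of "{}" X] that by simp
qed simp

lemma contraction_contraction:
  assumes "F \<subseteq> G" "G \<subseteq> E"
  shows "contraction (contraction M F) (G - F) = contraction M G"
proof -
  have F: "F \<subseteq> E" using assms by blast
  interpret C: matroid "contraction M F" by unfold_locales (rule matroid_contraction[OF F])
  interpret G: matroid "contraction M G" by unfold_locales (rule matroid_contraction[OF assms(2)])
  have GF: "G - F \<subseteq> C.E" using assms by auto
  show ?thesis
  proof (rule G.matroid_eqI)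
    show "is_matroid (contraction (contraction M F) (G - F))" by (rule C.matroid_contraction[OF GF])
    show "ground (contraction (contraction M F) (G - F)) = G.E" using assms by auto
    fix X assume X: "X \<subseteq> G.E"
    have "rank_of (contraction (contraction M F) (G - F)) X + C.r (G - F) = C.r (X \<union> (G - F))"
      using X assms by (intro C.rank_contraction) auto
    moreover have "C.r (G - F) + r F = r (G - F \<union> F)"
      using assms by (intro rank_contraction) auto
    moreover have "C.r (X \<union> (G - F)) + r F = r (X \<union> (G - F) \<union> F)"
      using X assms by (intro rank_contraction) auto
    moreover have "G.r X + r G = r (X \<union> G)"
      using X assms by (intro rank_contraction) auto
    moreover have "G - F \<union> F = G" "X \<union> (G - F) \<union> F = X \<union> G" using assms by auto
    ultimately show "rank_of (contraction (contraction M F) (G - F)) X = G.r X" by simp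
  qed
qed

lemma flat_subset: "F \<in> flats M \<Longrightarrow> F \<subseteq> E"
  by (simp add: flats_def is_flat_def)

lemma finite_flats: "finite (flats M)"
  by (rule finite_subset[of _ "Pow E"]) (use flat_subset finite_ground in auto)

lemma flats_contraction:
  assumes F: "F \<subseteq> E"
  shows "flats (contraction M F) = (\<lambda>G. G - F) ` {G \<in> flats M. F \<subseteq> G}"
proof -
  have *: "X \<in> flats (contraction M F) \<longleftrightarrow> X \<union> F \<in> flats M" if X: "X \<subseteq> E - F" for X
  proof -
    have "rank_of (contraction M F) X < rank_of (contraction M F) (insert e X) \<longleftrightarrow>
        r (X \<union> F) < r (insert e (X \<union> F))" if "e \<in> E - F" for e
    proof -
      have "rank_of (contraction M F) (insert e X) + r F = r (insert e (X \<union> F))"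
        using rank_contraction[OF F, of "insert e X"] X that by simp
      then show ?thesis using rank_contraction[OF F X] by (metis add_less_cancel_right)
    qed
    then show ?thesis using X F by (auto simp: flats_def is_flat_def)
  qed
  show ?thesis
  proof (intro equalityI subsetI)
    fix X assume X: "X \<in> flats (contraction M F)"
    then have "X \<subseteq> E - F" by (simp add: flats_def is_flat_def)
    then show "X \<in> (\<lambda>G. G - F) ` {G \<in> flats M. F \<subseteq> G}"
      using * X by (intro image_eqI[of _ _ "X \<union> F"]) auto
  next
    fix X assume "X \<in> (\<lambda>G. G - F) ` {G \<in> flats M. F \<subseteq> G}"
    then obtain G where G: "G \<in> flats M" "F \<subseteq> G" "X = G - F" by auto
    then show "X \<in> flats (contraction M F)" using *[of X] flat_subset[of G]
      by (simp add: Un_absorb2 Diff_mono)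
  qed
qed

lemma sum_flats_contraction:
  assumes "F \<in> flats M"
  shows "(\<Sum>X\<in>flats (contraction M F). g X) = (\<Sum>G\<in>{G \<in> flats M. F \<subseteq> G}. g (G - F))"
  unfolding flats_contraction[OF flat_subset[OF assms]]
  by (subst sum.reindex) (auto simp: inj_on_def)

lemma loopless_contraction:
  assumes "F \<in> flats M"
  shows "loopless (contraction M F)"
  unfolding loopless_def
proof
  have F: "F \<subseteq> E" using assms by (rule flat_subset)
  interpret C: matroid "contraction M F" by unfold_locales (rule matroid_contraction[OF F])
  fix e assume e: "e \<in> ground (contraction M F)"
  then have "r F < r (insert e F)" using assms by (auto simp: flats_def is_flat_def)
  moreover have "C.r {e} + r F = r ({e} \<union> F)" using e by (intro rank_contraction[OF F]) auto
  ultimately have "C.r {e} = card {e}" using C.rank_le_card[of "{e}"] by simp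
  then show "{e} \<in> indeps (contraction M F)" by (intro C.indep_if_rank) auto
qed

lemma flat_rank_strict_mono:
  assumes "F \<in> flats M" "G \<subseteq> E" "F \<subset> G"
  shows "r F < r G"
proof -
  obtain e where e: "e \<in> G - F" using assms by blast
  then have "r F < r (insert e F)" using assms by (auto simp: flats_def is_flat_def)
  also have "\<dots> \<le> r G" using e assms by (intro rank_mono) auto
  finally show ?thesis .
qed

lemma rank_restriction: "X \<subseteq> F \<Longrightarrow> rank_of (restriction M F) X = r X"
  unfolding rank_of_def restriction_def by (auto intro!: arg_cong[of _ _ "\<lambda>A. Max (card ` A)"])

lemma rk_restriction: "rk (restriction M F) = r F"
  unfolding rk_def by (subst rank_restriction) (auto simp: restriction_def)

lemma rk_restriction_restriction: "G \<subseteq> F \<Longrightarrow> rk (restriction (restriction M F) G) = r G"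
  unfolding rk_restriction[symmetric] by (auto simp: restriction_def intro!: arg_cong[of _ _ rk])

text \<open>A case of submodularity: extend a basis of \<open>G\<close> to one of \<open>F\<close>; the exchange property lets
  \<open>e\<close> be added to the latter, hence to the former.\<close>

lemma rank_insert_strict_antimono:
  assumes "G \<subseteq> F" "r F < r (insert e F)"
  shows "r G < r (insert e G)"
proof -
  obtain B where B: "is_basis_of M G B" using ex_basis by blast
  then obtain B' where B': "is_basis_of M F B'" "B \<subseteq> B'"
    using basis_extend[of B F] assms(1) by (auto simp: is_basis_of_def)
  obtain J where J: "J \<in> indeps M" "J \<subseteq> insert e F" "card J = r (insert e F)"
    using rank_attained by blast
  then obtain x where x: "x \<in> J - B'" "insert x B' \<in> indeps M"
    using indep_exchange[of B' J] basis_card[OF B'(1)] B' assms(2) by (auto simp: is_basis_of_def)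
  then have "x = e" "e \<notin> B" using B' J by (auto simp: is_basis_of_def)
  have "insert e B \<in> indeps M"
    by (rule indep_mono[OF x(2)]) (use B'(2) \<open>x = e\<close> in auto)
  then have "card (insert e B) \<le> r (insert e G)" using B by (intro card_le_rank) (auto simp: is_basis_of_def)
  then show ?thesis using \<open>e \<notin> B\<close> basis_card[OF B] B indep_finite[of B] by (simp add: is_basis_of_def)
qed

lemma flats_restriction:
  assumes F: "F \<in> flats M"
  shows "flats (restriction M F) = {G \<in> flats M. G \<subseteq> F}"
proof (intro equalityI subsetI)
  fix G assume G: "G \<in> flats (restriction M F)"
  then have GF: "G \<subseteq> F" by (simp add: flats_def is_flat_def restriction_def)
  have "r G < r (insert e G)" if e: "e \<in> E - G" for e
  proof (cases "e \<in> F")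
    case True
    then have "rank_of (restriction M F) G < rank_of (restriction M F) (insert e G)"
      using G e by (simp add: flats_def is_flat_def restriction_def)
    then show ?thesis using True GF by (simp add: rank_restriction)
  next
    case False
    then have "r F < r (insert e F)" using F e by (auto simp: flats_def is_flat_def)
    then show ?thesis by (rule rank_insert_strict_antimono[OF GF])
  qed
  then show "G \<in> {G \<in> flats M. G \<subseteq> F}" using GF flat_subset[OF F] by (auto simp: flats_def is_flat_def)
next
  fix G assume G: "G \<in> {G \<in> flats M. G \<subseteq> F}"
  have "rank_of (restriction M F) G < rank_of (restriction M F) (insert e G)" if "e \<in> F - G" for e
    using G that flat_subset[OF F] rank_restriction[of G F] rank_restriction[of "insert e G" F]
    by (auto simp: flats_def is_flat_def)
  then show "G \<in> flats (restriction M F)"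
    using G by (auto simp: flats_def is_flat_def restriction_def)
qed

end

locale loopless_matroid = matroid +
  assumes loopless: "loopless M"
begin

lemma empty_flat: "{} \<in> flats M"
  using loopless rank_indep by (auto simp: flats_def is_flat_def loopless_def)

lemma loopless_matroid_contraction:
  "F \<in> flats M \<Longrightarrow> loopless_matroid (contraction M F)"
  by unfold_locales (simp_all add: matroid_contraction flat_subset loopless_contraction)

lemma ground_empty_if_rk_0: "rk M = 0 \<Longrightarrow> E = {}"
  using flat_rank_strict_mono[OF empty_flat, of E] by (auto simp: rk_def)

end

section \<open>Kazhdan--Lusztig polynomials from self-reciprocal sums\<close>

text \<open>Palindromic coefficients, as a functional equation. It is stated for functions because the sums
  over flats below are manipulated pointwise.\<close>

definition self_reciprocal :: "nat \<Rightarrow> (real \<Rightarrow> real) \<Rightarrow> bool" where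
  "self_reciprocal d f \<longleftrightarrow> (\<forall>x. x \<noteq> 0 \<longrightarrow> x ^ d * f (inverse x) = f x)"

lemma self_reciprocalI_coeff:
  assumes "degree p \<le> d" "\<And>k. k \<le> d \<Longrightarrow> coeff p k = coeff p (d - k)"
  shows "self_reciprocal d (poly p)"
  unfolding self_reciprocal_def
proof (intro allI impI)
  fix x :: real assume x: "x \<noteq> 0"
  have alt: "poly p y = (\<Sum>k\<le>d. coeff p k * y ^ k)" for y
    unfolding poly_altdef using assms(1)
    by (intro sum.mono_neutral_left) (auto simp: coeff_eq_0)
  have "x ^ d * poly p (inverse x) = (\<Sum>k\<le>d. coeff p k * x ^ (d - k))"
    unfolding alt sum_distrib_left
    by (intro sum.cong) (use x in \<open>auto simp: power_diff field_simps\<close>)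
  also have "\<dots> = (\<Sum>k\<le>d. coeff p k * x ^ k)"
    by (rule sum.reindex_bij_witness[of _ "\<lambda>k. d - k" "\<lambda>k. d - k"])
       (auto simp: assms(2)[symmetric])
  finally show "x ^ d * poly p (inverse x) = poly p x" by (simp only: alt)
qed

text \<open>The source of uniqueness: a palindromic polynomial of degree less than \<open>d / 2\<close> vanishes, since
  its reflection is divisible by a power of \<open>x\<close> exceeding its degree.\<close>

lemma self_reciprocal_eq_0:
  assumes "self_reciprocal d (poly p)" "2 * degree p < d"
  shows "p = 0"
proof -
  define q where "q = monom 1 (d - degree p) * reflect_poly p"
  have "poly (pCons 0 q) x = poly (pCons 0 p) x" for x
  proof (cases "x = 0")
    case False
    have "poly q x = x ^ d * poly p (inverse x)"
      unfolding q_def using assms(2) False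
      by (simp add: poly_reflect_poly_nz poly_monom flip: power_add mult.assoc)
    also have "\<dots> = poly p x" using assms(1) False by (simp add: self_reciprocal_def)
    finally show ?thesis by simp
  qed simp
  then have "pCons 0 q = pCons 0 p" using poly_eq_poly_eq_iff by blast
  then have "q = p" by simp
  then have "lead_coeff p = coeff q (degree p)" by simp
  also have "\<dots> = 0" using assms(2) by (simp add: q_def coeff_monom_mult)
  finally show ?thesis by simp
qed

lemma self_reciprocal_diff:
  "self_reciprocal d f \<Longrightarrow> self_reciprocal d g \<Longrightarrow> self_reciprocal d (\<lambda>x. f x - g x)"
  by (simp add: self_reciprocal_def right_diff_distrib)

lemma self_reciprocal_0_const: "self_reciprocal 0 (\<lambda>_. c)"
  by (simp add: self_reciprocal_def)

text \<open>Known as the Z-polynomial of the matroid when \<open>P\<close> assigns the Kazhdan--Lusztig polynomials.\<close>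

definition Z_sum :: "('a matroid \<Rightarrow> int poly) \<Rightarrow> 'a matroid \<Rightarrow> real \<Rightarrow> real" where
  "Z_sum P M x = (\<Sum>F\<in>flats M. x ^ rank_of M F * poly (real_poly (P (contraction M F))) x)"

lemma mobius_restrict:
  assumes "finite G" "G \<subseteq> F"
  shows "mobius {H \<in> L. H \<subseteq> F} A G = mobius L A G"
  using assms
proof (induction G rule: finite_psubset_induct)
  case (psubset G)
  have "(\<Sum>C | C \<in> {H \<in> L. H \<subseteq> F} \<and> A \<subseteq> C \<and> C \<subset> G. mobius {H \<in> L. H \<subseteq> F} A C) =
      (\<Sum>C | C \<in> L \<and> A \<subseteq> C \<and> C \<subset> G. mobius L A C)"
    by (rule sum.cong) (use psubset in auto)
  then show ?case by (simp only: mobius.simps[of _ A G])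
qed

lemma (in loopless_matroid) sum_mobius_flats:
  assumes F: "F \<in> flats M"
  shows "(\<Sum>G\<in>{G \<in> flats M. G \<subseteq> F}. mobius (flats M) {} G) = (if F = {} then 1 else 0)"
proof (cases "F = {}")
  case True
  then have "{G \<in> flats M. G \<subseteq> F} = {{}}" using empty_flat by auto
  then show ?thesis using True by (simp add: mobius.simps)
next
  case False
  have fin: "finite F" using F flat_subset finite_subset_ground by blast
  have "{G \<in> flats M. G \<subseteq> F} = insert F {C. C \<in> flats M \<and> {} \<subseteq> C \<and> C \<subset> F}" using F by auto
  moreover have "mobius (flats M) {} F = - (\<Sum>C | C \<in> flats M \<and> {} \<subseteq> C \<and> C \<subset> F. mobius (flats M) {} C)"
    using False fin by (subst mobius.simps) auto
  moreover have "finite {C. C \<in> flats M \<and> {} \<subseteq> C \<and> C \<subset> F}"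
    using finite_flats by simp
  ultimately show ?thesis using False by simp
qed

lemma (in loopless_matroid) poly_char_poly_restriction:
  assumes F: "F \<in> flats M"
  shows "poly (real_poly (char_poly_matroid (restriction M F))) x =
    (\<Sum>G\<in>{G \<in> flats M. G \<subseteq> F}. of_int (mobius (flats M) {} G) * x ^ (r F - r G))"
  unfolding char_poly_matroid_def flats_restriction[OF F] map_poly_of_int_sum poly_sum rk_restriction
proof (rule sum.cong)
  fix G assume G: "G \<in> {G \<in> flats M. G \<subseteq> F}"
  then have "finite G" using flat_subset finite_subset_ground by blast
  then show "poly (real_poly (monom (mobius {G \<in> flats M. G \<subseteq> F} {} G)
      (r F - rk (restriction (restriction M F) G)))) x =
      of_int (mobius (flats M) {} G) * x ^ (r F - r G)"
    using G by (simp add: mobius_restrict rk_restriction_restriction map_poly_monom poly_monom)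
qed simp

lemma (in loopless_matroid) Z_sum_contraction:
  assumes F: "F \<in> flats M"
  shows "Z_sum P (contraction M F) x =
    (\<Sum>G\<in>{G \<in> flats M. F \<subseteq> G}. x ^ (r G - r F) * poly (real_poly (P (contraction M G))) x)"
  unfolding Z_sum_def sum_flats_contraction[OF F]
proof (rule sum.cong)
  fix G assume G: "G \<in> {G \<in> flats M. F \<subseteq> G}"
  then have GF: "F \<subseteq> G" "G \<subseteq> E" using flat_subset by auto
  then have "rank_of (contraction M F) (G - F) + r F = r (G - F \<union> F)"
    by (intro rank_contraction) auto
  moreover have "G - F \<union> F = G" using GF by auto
  ultimately have "rank_of (contraction M F) (G - F) = r G - r F" by simp
  then show "x ^ rank_of (contraction M F) (G - F) *
      poly (real_poly (P (contraction (contraction M F) (G - F)))) x =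
      x ^ (r G - r F) * poly (real_poly (P (contraction M G))) x"
    by (simp add: contraction_contraction[OF GF])
qed simp

text \<open>Expand the characteristic polynomials by the Moebius function and exchange the two sums over flats
  \<open>G \<subseteq> F\<close>. For fixed \<open>G\<close> the inner sum is \<open>Z_sum P\<close> of the contraction by \<open>G\<close>; applying its
  palindromicity and exchanging the sums back leaves \<open>\<Sum>G\<subseteq>F. \<mu>(G)\<close>, which vanishes unless \<open>F = {}\<close>.\<close>

lemma (in loopless_matroid) KL_identity_of_self_reciprocal:
  assumes Z: "\<And>F. F \<in> flats M \<Longrightarrow> self_reciprocal (rk M - r F) (Z_sum P (contraction M F))"
    and x: "x \<noteq> 0"
  shows "x ^ rk M * poly (real_poly (P M)) (inverse x) =
    (\<Sum>F\<in>flats M. poly (real_poly (char_poly_matroid (restriction M F))) x *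
       poly (real_poly (P (contraction M F))) x)"
proof -
  let ?L = "flats M" and ?\<mu> = "\<lambda>G. real_of_int (mobius (flats M) {} G)"
  let ?p = "\<lambda>F. poly (real_poly (P (contraction M F)))"
  have exps: "x ^ (rk M - r G) * inverse x ^ (r F - r G) = x ^ (rk M - r F)"
    if "G \<subseteq> F" "F \<in> ?L" for F G
  proof -
    have "r G \<le> r F" "r F \<le> rk M"
      using that rank_mono rank_le_rk flat_subset by auto
    then have "x ^ (rk M - r G) = x ^ (rk M - r F) * x ^ (r F - r G)"
      by (simp flip: power_add)
    then show ?thesis using x by (simp add: power_inverse)
  qed
  have "(\<Sum>F\<in>?L. poly (real_poly (char_poly_matroid (restriction M F))) x * ?p F x) =
      (\<Sum>F\<in>?L. \<Sum>G\<in>{G \<in> ?L. G \<subseteq> F}. ?\<mu> G * (x ^ (r F - r G) * ?p F x))"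
    by (rule sum.cong) (simp_all add: poly_char_poly_restriction sum_distrib_right mult.assoc)
  also have "\<dots> = (\<Sum>G\<in>?L. \<Sum>F\<in>{F \<in> ?L. G \<subseteq> F}. ?\<mu> G * (x ^ (r F - r G) * ?p F x))"
    by (rule sum.swap_restrict[OF finite_flats finite_flats])
  also have "\<dots> = (\<Sum>G\<in>?L. ?\<mu> G * Z_sum P (contraction M G) x)"
    by (rule sum.cong) (simp_all add: Z_sum_contraction sum_distrib_left)
  also have "\<dots> = (\<Sum>G\<in>?L. ?\<mu> G * (x ^ (rk M - r G) * Z_sum P (contraction M G) (inverse x)))"
    by (rule sum.cong) (use Z x in \<open>auto simp: self_reciprocal_def\<close>)
  also have "\<dots> = (\<Sum>G\<in>?L. \<Sum>F\<in>{F \<in> ?L. G \<subseteq> F}. ?\<mu> G * (x ^ (rk M - r F) * ?p F (inverse x)))"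
    by (rule sum.cong) (auto simp: Z_sum_contraction sum_distrib_left exps mult.assoc[symmetric]
        intro!: sum.cong)
  also have "\<dots> = (\<Sum>F\<in>?L. \<Sum>G\<in>{G \<in> ?L. G \<subseteq> F}. ?\<mu> G * (x ^ (rk M - r F) * ?p F (inverse x)))"
    by (rule sum.swap_restrict[OF finite_flats finite_flats])
  also have "\<dots> = (\<Sum>F\<in>?L. (if F = {} then 1 else 0) * (x ^ (rk M - r F) * ?p F (inverse x)))"
  proof (rule sum.cong)
    fix F assume F: "F \<in> ?L"
    have "(\<Sum>G\<in>{G \<in> ?L. G \<subseteq> F}. ?\<mu> G) = (if F = {} then 1 else 0)"
      using sum_mobius_flats[OF F] by (simp flip: of_int_sum)
    then show "(\<Sum>G\<in>{G \<in> ?L. G \<subseteq> F}. ?\<mu> G * (x ^ (rk M - r F) * ?p F (inverse x))) =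
        (if F = {} then 1 else 0) * (x ^ (rk M - r F) * ?p F (inverse x))"
      by (simp only: sum_distrib_right[symmetric])
  qed simp
  also have "\<dots> = (\<Sum>F\<in>?L. if F = {} then x ^ (rk M - r F) * ?p F (inverse x) else 0)"
    by (rule sum.cong) auto
  also have "\<dots> = x ^ rk M * poly (real_poly (P M)) (inverse x)"
    using finite_flats empty_flat by (simp add: contraction_empty)
  finally show ?thesis ..
qed

text \<open>With \<open>R\<close> the part of \<open>Z_sum\<close> coming from nonempty flats, palindromicity of \<open>P\<^sub>M + R\<close> and the degree
  bound force the coefficient of \<open>P\<^sub>M\<close> in each degree \<open>k < rk M / 2\<close>. The value for infinite ground
  sets only serves termination.\<close>

function KL_rec :: "'a matroid \<Rightarrow> int poly" where
  "KL_rec M = (if rk M = 0 \<or> infinite (ground M) then 1 else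
     let R = (\<Sum>F\<in>flats M - {{}}. monom 1 (rank_of M F) * KL_rec (contraction M F))
     in \<Sum>k\<in>{k. 2 * k < rk M}. monom (coeff R (rk M - k) - coeff R k) k)"
  by pat_completeness auto
termination
proof (relation "measure (card \<circ> ground)")
  fix M :: "'a matroid" and F
  assume "\<not> (rk M = 0 \<or> infinite (ground M))" "F \<in> flats M - {{}}"
  then show "(contraction M F, M) \<in> measure (card \<circ> ground)"
    by (auto simp: contraction_def flats_def is_flat_def intro!: psubset_card_mono)
qed simp

declare KL_rec.simps [simp del]

lemma (in loopless_matroid) Z_sum_split:
  "Z_sum P M x = poly (real_poly (P M +
     (\<Sum>F\<in>flats M - {{}}. monom 1 (r F) * P (contraction M F)))) x"
proof -
  have "Z_sum P M x = x ^ r {} * poly (real_poly (P (contraction M {}))) x +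
      (\<Sum>F\<in>flats M - {{}}. x ^ r F * poly (real_poly (P (contraction M F))) x)"
    unfolding Z_sum_def by (rule sum.remove[OF finite_flats empty_flat])
  then show ?thesis
    by (simp add: contraction_empty map_poly_of_int_simps poly_sum poly_monom)
qed

lemma KL_rec_correct:
  assumes "loopless_matroid M"
  shows "(rk M = 0 \<longrightarrow> KL_rec M = 1) \<and> (rk M > 0 \<longrightarrow> 2 * degree (KL_rec M) < rk M) \<and>
    self_reciprocal (rk M) (Z_sum KL_rec M)"
  using assms
proof (induction "card (ground M)" arbitrary: M rule: less_induct)
  case less
  interpret loopless_matroid M by (rule less.prems)
  show ?case
  proof (cases "rk M = 0")
    case True
    then have "E = {}" by (rule ground_empty_if_rk_0)
    then have "flats M = {{}}" using flat_subset empty_flat by auto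
    then have "Z_sum KL_rec M = (\<lambda>x. 1)"
      using True by (simp add: fun_eq_iff Z_sum_def contraction_empty KL_rec.simps)
    then show ?thesis using True self_reciprocal_0_const by (simp add: KL_rec.simps)
  next
    case False
    define R where "R = (\<Sum>F\<in>flats M - {{}}. monom 1 (r F) * KL_rec (contraction M F))"
    define d where "d = rk M"
    have K: "KL_rec M = (\<Sum>k\<in>{k. 2 * k < d}. monom (coeff R (d - k) - coeff R k) k)"
      using False finite_ground by (subst KL_rec.simps) (simp add: R_def d_def Let_def)
    have fin: "finite {k. 2 * k < d}" by (rule finite_subset[of _ "{..d}"]) auto
    have coeff: "coeff (KL_rec M) k = (if 2 * k < d then coeff R (d - k) - coeff R k else 0)" for k
    proof -
      have "coeff (KL_rec M) k =
          (\<Sum>i\<in>{k. 2 * k < d}. if i = k then coeff R (d - k) - coeff R k else 0)"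
        unfolding K coeff_sum by (rule sum.cong) auto
      then show ?thesis using fin by simp
    qed
    have deg: "2 * degree (KL_rec M) < d"
    proof (rule ccontr)
      assume *: "\<not> ?thesis"
      then have "lead_coeff (KL_rec M) = 0" by (simp only: coeff if_False)
      then show False using * False by (simp add: d_def)
    qed
    have degR: "degree R \<le> d"
      unfolding R_def
    proof (rule degree_sum_le)
      fix F assume F: "F \<in> flats M - {{}}"
      then have FE: "F \<subseteq> E" using flat_subset by auto
      interpret C: loopless_matroid "contraction M F"
        using F by (intro loopless_matroid_contraction) auto
      have "card (ground (contraction M F)) < card E"
        using F FE finite_ground by (auto intro!: psubset_card_mono)
      then have "degree (KL_rec (contraction M F)) \<le> rk (contraction M F)"
        using less.hyps[of "contraction M F"] C.loopless_matroid_axioms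
        by (cases "rk (contraction M F) = 0") auto
      then have "r F + degree (KL_rec (contraction M F)) \<le> d"
        using rk_contraction[OF FE] rank_le_rk[OF FE] by (simp add: d_def)
      then show "degree (monom 1 (r F) * KL_rec (contraction M F)) \<le> d"
        using degree_mult_le[of "monom 1 (r F)" "KL_rec (contraction M F)"]
          degree_monom_le[of "1 :: int" "r F"] by linarith
    qed (simp add: finite_flats)
    have "Z_sum KL_rec M = poly (real_poly (KL_rec M + R))"
      by (rule ext) (simp only: Z_sum_split R_def)
    moreover have "self_reciprocal d (poly (real_poly (KL_rec M + R)))"
    proof (rule self_reciprocalI_coeff)
      show "degree (real_poly (KL_rec M + R)) \<le> d"
        using deg degR by (simp add: degree_add_le)
      show "coeff (real_poly (KL_rec M + R)) k = coeff (real_poly (KL_rec M + R)) (d - k)"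
        if "k \<le> d" for k
      proof -
        consider "2 * k < d" | "2 * k = d" | "2 * k > d" by linarith
        then show ?thesis
        proof cases
          case 2
          then have "d - k = k" by simp
          then show ?thesis by simp
        qed (use that in \<open>auto simp: coeff_map_poly coeff\<close>)
      qed
    qed
    ultimately show ?thesis using False deg by (simp add: d_def)
  qed
qed

lemma KL_assignment_KL_rec: "KL_assignment KL_rec"
  unfolding KL_assignment_def
proof (intro allI impI conjI)
  fix M :: "'a matroid"
  assume "is_matroid M \<and> loopless M"
  then interpret loopless_matroid M by unfold_locales auto
  note K = KL_rec_correct[OF loopless_matroid_axioms]
  show "KL_rec M = 1" if "rk M = 0" using K that by blast
  show "real (degree (KL_rec M)) < real (rk M) / 2" if "rk M > 0" using K that by linarith
  fix x :: real assume "x \<noteq> 0"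
  have Z: "self_reciprocal (rk M - r F) (Z_sum KL_rec (contraction M F))" if "F \<in> flats M" for F
    using KL_rec_correct[OF loopless_matroid_contraction[OF that]]
      rk_contraction[OF flat_subset[OF that]] by simp
  show "x ^ rk M * poly (real_poly (KL_rec M)) (inverse x) =
    (\<Sum>F\<in>flats M. poly (real_poly (char_poly_matroid (restriction M F))) x *
       poly (real_poly (KL_rec (contraction M F))) x)"
    by (rule KL_identity_of_self_reciprocal[OF Z \<open>x \<noteq> 0\<close>])
qed

text \<open>Two assignments that agree on proper contractions differ on \<open>M\<close> by a palindromic polynomial of small
  degree, because the empty flat enters the identity with characteristic polynomial \<open>1\<close>.\<close>

lemma KL_assignment_unique:
  assumes P: "KL_assignment P" and Q: "KL_assignment Q" and "loopless_matroid M"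
  shows "P M = Q M"
  using assms(3)
proof (induction "card (ground M)" arbitrary: M rule: less_induct)
  case less
  interpret loopless_matroid M by (rule less.prems)
  have KL: "(rk M = 0 \<longrightarrow> T M = 1) \<and> (rk M > 0 \<longrightarrow> 2 * degree (T M) < rk M) \<and>
      (\<forall>x. x \<noteq> 0 \<longrightarrow> x ^ rk M * poly (real_poly (T M)) (inverse x) =
         (\<Sum>F\<in>flats M. poly (real_poly (char_poly_matroid (restriction M F))) x *
            poly (real_poly (T (contraction M F))) x))" if "KL_assignment T" for T
  proof -
    have "is_matroid M \<and> loopless M" using matroid loopless by simp
    note T = that[unfolded KL_assignment_def, THEN spec, THEN mp, OF this]
    have "rk M > 0 \<longrightarrow> 2 * degree (T M) < rk M" using T by linarith
    with T show ?thesis by blast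
  qed
  note PM = KL[OF P] and QM = KL[OF Q]
  show ?case
  proof (cases "rk M = 0")
    case False
    have IH: "P (contraction M F) = Q (contraction M F)" if "F \<in> flats M - {{}}" for F
    proof (rule less.hyps)
      show "loopless_matroid (contraction M F)" using that loopless_matroid_contraction by auto
      show "card (ground (contraction M F)) < card E"
        using that flat_subset[of F] finite_ground by (auto intro!: psubset_card_mono)
    qed
    have one: "poly (real_poly (char_poly_matroid (restriction M {}))) x = 1" for x
    proof -
      have "{G \<in> flats M. G \<subseteq> {}} = {{}}" using empty_flat by auto
      then show ?thesis
        unfolding poly_char_poly_restriction[OF empty_flat] by (simp add: mobius.simps)
    qed
    have "self_reciprocal (rk M) (poly (real_poly (P M - Q M)))"
      unfolding self_reciprocal_def
    proof (intro allI impI)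
      fix x :: real assume x: "x \<noteq> 0"
      show "x ^ rk M * poly (real_poly (P M - Q M)) (inverse x) = poly (real_poly (P M - Q M)) x"
      proof -
        have "x ^ rk M * poly (real_poly (T M)) (inverse x) = poly (real_poly (T M)) x +
            (\<Sum>F\<in>flats M - {{}}. poly (real_poly (char_poly_matroid (restriction M F))) x *
               poly (real_poly (T (contraction M F))) x)" if "KL_assignment T" for T
          using KL[OF that] x
          by (subst (asm) sum.remove[OF finite_flats empty_flat]) (simp add: one contraction_empty)
        from this[OF P] this[OF Q] show ?thesis
          using IH by (simp add: map_poly_of_int_simps right_diff_distrib)
      qed
    qed
    moreover have "2 * degree (real_poly (P M - Q M)) < rk M"
    proof -
      have "2 * degree (P M) < rk M" "2 * degree (Q M) < rk M" using PM QM False by auto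
      then show ?thesis using degree_diff_le_max[of "P M" "Q M"] by (simp add: max_def split: if_splits)
    qed
    ultimately have "real_poly (P M - Q M) = 0" by (rule self_reciprocal_eq_0)
    then show ?thesis by (simp add: poly_eq_iff coeff_map_poly)
  qed (use PM QM in simp)
qed

lemma KL_poly_eq_KL_rec:
  assumes "loopless_matroid M"
  shows "KL_poly M = KL_rec M"
  unfolding KL_poly_def
  by (rule the_equality) (use KL_assignment_KL_rec KL_assignment_unique[OF _ _ assms] in blast)+

text \<open>The polynomials of all contractions are determined together, by induction from the large flats
  down: at \<open>F\<close> only the summand for \<open>G = F\<close> is not yet known to agree.\<close>

theorem (in loopless_matroid) KL_poly_eqI:
  assumes top: "f E = 1"
    and deg: "\<And>F. F \<in> flats M \<Longrightarrow> F \<noteq> E \<Longrightarrow> 2 * degree (f F) < rk M - r F"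
    and Z: "\<And>F. F \<in> flats M \<Longrightarrow> self_reciprocal (rk M - r F)
      (\<lambda>x. \<Sum>G\<in>{G \<in> flats M. F \<subseteq> G}. x ^ (r G - r F) * poly (real_poly (f G)) x)"
  shows "KL_poly M = f {}"
proof -
  have "KL_rec (contraction M F) = f F" if "F \<in> flats M" for F
    using that
  proof (induction "card (E - F)" arbitrary: F rule: less_induct)
    case less
    note F = less.prems
    have FE: "F \<subseteq> E" using F by (rule flat_subset)
    let ?K = "KL_rec (contraction M F)"
    have rkF: "rk (contraction M F) = rk M - r F" by (rule rk_contraction[OF FE])
    note K = KL_rec_correct[OF loopless_matroid_contraction[OF F], unfolded rkF]
    show ?case
    proof (cases "F = E")
      case True
      then show ?thesis using K top by (simp add: rk_def)
    next
      case False
      have lt: "r F < rk M" unfolding rk_def using F FE False by (intro flat_rank_strict_mono) auto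
      have IH: "KL_rec (contraction M G) = f G" if "G \<in> flats M" "F \<subseteq> G" "G \<noteq> F" for G
      proof (rule less.hyps[OF _ that(1)])
        show "card (E - G) < card (E - F)"
          using that flat_subset[of G] finite_ground by (intro psubset_card_mono) auto
      qed
      have mem: "F \<in> {G \<in> flats M. F \<subseteq> G}" "finite {G \<in> flats M. F \<subseteq> G}"
        using F finite_flats by auto
      have "Z_sum KL_rec (contraction M F) x -
          (\<Sum>G\<in>{G \<in> flats M. F \<subseteq> G}. x ^ (r G - r F) * poly (real_poly (f G)) x) =
          poly (real_poly (?K - f F)) x" for x
        unfolding Z_sum_contraction[OF F] sum_subtractf[symmetric]
        by (subst sum.remove[OF mem(2) mem(1)], subst sum.neutral)
           (use IH in \<open>auto simp: map_poly_of_int_simps\<close>)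
      then have "self_reciprocal (rk M - r F) (poly (real_poly (?K - f F)))"
        using self_reciprocal_diff[OF _ Z[OF F]] K by fastforce
      moreover have "2 * degree (real_poly (?K - f F)) < rk M - r F"
        using K deg[OF F False] lt degree_diff_le_max[of ?K "f F"]
        by (simp add: max_def split: if_splits)
      ultimately have "real_poly (?K - f F) = 0" by (rule self_reciprocal_eq_0)
      then show ?thesis by (simp add: poly_eq_iff coeff_map_poly)
    qed
  qed
  from this[OF empty_flat] show ?thesis
    by (simp add: contraction_empty KL_poly_eq_KL_rec[OF loopless_matroid_axioms])
qed

section \<open>Palindromicity of the thagomizer sums\<close>

lemma sum_Pow_card:
  fixes h :: "nat \<Rightarrow> real"
  assumes "finite U"
  shows "(\<Sum>T\<in>Pow U. h (card T)) = (\<Sum>j\<le>card U. real (card U choose j) * h j)"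
proof -
  have "(\<Sum>T\<in>Pow U. h (card T)) = (\<Sum>j\<le>card U. \<Sum>T\<in>{T \<in> Pow U. card T = j}. h (card T))"
    by (rule sum.group[symmetric]) (use assms card_mono in auto)
  also have "\<dots> = (\<Sum>j\<le>card U. real (card U choose j) * h j)"
    by (rule sum.cong) (use n_subsets[OF assms] in \<open>auto simp: Pow_def\<close>)
  finally show ?thesis .
qed

lemma sum_Pow_power_card:
  assumes "finite U"
  shows "(\<Sum>T\<in>Pow U. x ^ card T) = (1 + x :: real) ^ card U"
  unfolding sum_Pow_card[OF assms, of "\<lambda>j. x ^ j"] add.commute[of 1 x] binomial_ring
  by simp

text \<open>If \<open>s k\<close> is the \<open>k\<close>-th moment of a random variable, this is the \<open>n\<close>-th moment of that variable
  shifted by \<open>a\<close>.\<close>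

definition binomial_transform :: "real \<Rightarrow> (nat \<Rightarrow> real) \<Rightarrow> nat \<Rightarrow> real" where
  "binomial_transform a s n = (\<Sum>j\<le>n. real (n choose j) * a ^ j * s (n - j))"

lemma binomial_transform_Suc:
  "binomial_transform a s (Suc n) =
     binomial_transform a (\<lambda>k. s (Suc k)) n + a * binomial_transform a s n"
proof -
  have "binomial_transform a s (Suc n) =
      s (Suc n) + (\<Sum>j\<le>n. real (Suc n choose Suc j) * a ^ Suc j * s (n - j))"
    unfolding binomial_transform_def by (subst sum.atMost_Suc_shift) simp
  also have "\<dots> = (s (Suc n) + (\<Sum>j\<le>n. real (n choose Suc j) * a ^ Suc j * s (Suc n - Suc j))) +
      a * binomial_transform a s n"
    by (simp add: binomial_transform_def sum_distrib_left sum.distrib algebra_simps)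
  also have "s (Suc n) + (\<Sum>j\<le>n. real (n choose Suc j) * a ^ Suc j * s (Suc n - Suc j)) =
      (\<Sum>j\<le>Suc n. real (n choose j) * a ^ j * s (Suc n - j))"
    by (subst sum.atMost_Suc_shift) simp
  also have "\<dots> = binomial_transform a (\<lambda>k. s (Suc k)) n"
    by (simp add: binomial_transform_def Suc_diff_le)
  finally show ?thesis .
qed

text \<open>Both sides count the ways to choose disjoint sets of sizes \<open>j\<close> and \<open>m\<close>.\<close>

lemma choose_mult_commute:
  "(n choose j) * ((n - j) choose m) = (n choose m) * ((n - m) choose j)"
proof (cases "j + m \<le> n")
  case True
  have "(n choose (n - j)) * ((n - j) choose m) = (n choose m) * ((n - m) choose (n - j - m))"
    by (rule choose_mult) (use True in auto)
  moreover have "n choose (n - j) = n choose j" using True by (metis add_leD1 binomial_symmetric)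
  moreover have "(n - m) choose (n - j - m) = (n - m) choose j"
    using True binomial_symmetric[of j "n - m"] by (simp add: add.commute)
  ultimately show ?thesis by simp
next
  case False
  then show ?thesis by (cases "j \<le> n"; cases "m \<le> n") (auto simp: binomial_eq_0)
qed

lemma poly_motzkin:
  "poly (real_poly (motzkin n)) x = (\<Sum>k\<le>n. real ((n choose (2 * k)) * catalan k) * 2 ^ (n - 2 * k) * x ^ k)"
  unfolding motzkin_def map_poly_of_int_sum poly_sum
  by (rule sum.cong) (simp_all add: map_poly_monom poly_monom)

text \<open>The two colours of level steps have total weight \<open>2\<close>; the shift by \<open>2 * x\<close> raises it to
  \<open>2 * x + 2\<close>. Every summand is now palindromic of degree \<open>n\<close>.\<close>

lemma binomial_transform_motzkin:
  "binomial_transform (2 * x) (\<lambda>k. poly (real_poly (motzkin k)) x) n =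
     (\<Sum>k\<le>n. real ((n choose (2 * k)) * catalan k) * x ^ k * (2 * x + 2) ^ (n - 2 * k))"
proof -
  have ext: "poly (real_poly (motzkin (n - j))) x =
      (\<Sum>k\<le>n. real (((n - j) choose (2 * k)) * catalan k) * 2 ^ (n - j - 2 * k) * x ^ k)" for j
    unfolding poly_motzkin by (rule sum.mono_neutral_left) (auto simp: binomial_eq_0)
  have inner: "(\<Sum>j\<le>n. real (n choose j) * (2 * x) ^ j * (real ((n - j) choose (2 * k)) * 2 ^ (n - j - 2 * k))) =
      real (n choose (2 * k)) * (2 * x + 2) ^ (n - 2 * k)" for k
  proof (cases "2 * k \<le> n")
    case True
    have "(\<Sum>j\<le>n. real (n choose j) * (2 * x) ^ j * (real ((n - j) choose (2 * k)) * 2 ^ (n - j - 2 * k))) =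
        (\<Sum>j\<le>n. real ((n choose j) * ((n - j) choose (2 * k))) * ((2 * x) ^ j * 2 ^ (n - 2 * k - j)))"
      by (rule sum.cong) (simp_all add: add.commute)
    also have "\<dots> = (\<Sum>j\<le>n. real (n choose (2 * k)) *
        (real ((n - 2 * k) choose j) * (2 * x) ^ j * 2 ^ (n - 2 * k - j)))"
    proof (rule sum.cong)
      fix j
      show "real ((n choose j) * ((n - j) choose (2 * k))) * ((2 * x) ^ j * 2 ^ (n - 2 * k - j)) =
          real (n choose (2 * k)) * (real ((n - 2 * k) choose j) * (2 * x) ^ j * 2 ^ (n - 2 * k - j))"
        by (subst choose_mult_commute) simp
    qed simp
    also have "\<dots> = (\<Sum>j\<le>n - 2 * k. real (n choose (2 * k)) *
        (real ((n - 2 * k) choose j) * (2 * x) ^ j * 2 ^ (n - 2 * k - j)))"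
      by (rule sum.mono_neutral_right) auto
    also have "\<dots> = real (n choose (2 * k)) * (2 * x + 2) ^ (n - 2 * k)"
      unfolding binomial_ring sum_distrib_left by simp
    finally show ?thesis .
  qed (auto intro!: sum.neutral simp: binomial_eq_0)
  have "binomial_transform (2 * x) (\<lambda>k. poly (real_poly (motzkin k)) x) n =
      (\<Sum>j\<le>n. \<Sum>k\<le>n. real (catalan k) * x ^ k *
        (real (n choose j) * (2 * x) ^ j * (real ((n - j) choose (2 * k)) * 2 ^ (n - j - 2 * k))))"
    unfolding binomial_transform_def ext sum_distrib_left
    by (intro sum.cong) (simp_all add: mult_ac)
  also have "\<dots> = (\<Sum>k\<le>n. real (catalan k) * x ^ k *
      (\<Sum>j\<le>n. real (n choose j) * (2 * x) ^ j * (real ((n - j) choose (2 * k)) * 2 ^ (n - j - 2 * k))))"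
    unfolding sum_distrib_left by (rule sum.swap)
  also have "\<dots> = (\<Sum>k\<le>n. real ((n choose (2 * k)) * catalan k) * x ^ k * (2 * x + 2) ^ (n - 2 * k))"
    unfolding inner by (rule sum.cong) (simp_all add: mult_ac)
  finally show ?thesis .
qed

lemma self_reciprocal_add:
  "self_reciprocal d f \<Longrightarrow> self_reciprocal d g \<Longrightarrow> self_reciprocal d (\<lambda>x. f x + g x)"
  by (simp add: self_reciprocal_def distrib_left)

lemma self_reciprocal_mult:
  assumes "self_reciprocal d f" "self_reciprocal e g"
  shows "self_reciprocal (d + e) (\<lambda>x. f x * g x)"
  unfolding self_reciprocal_def
proof (intro allI impI)
  fix x :: real assume "x \<noteq> 0"
  have "x ^ (d + e) * (f (inverse x) * g (inverse x)) = (x ^ d * f (inverse x)) * (x ^ e * g (inverse x))"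
    by (simp add: power_add)
  also have "\<dots> = f x * g x" using assms \<open>x \<noteq> 0\<close> by (simp add: self_reciprocal_def)
  finally show "x ^ (d + e) * (f (inverse x) * g (inverse x)) = f x * g x" .
qed

lemma self_reciprocal_sum:
  "(\<And>i. i \<in> S \<Longrightarrow> self_reciprocal d (f i)) \<Longrightarrow> self_reciprocal d (\<lambda>x. \<Sum>i\<in>S. f i x)"
  by (simp add: self_reciprocal_def sum_distrib_left)

lemma self_reciprocal_X: "self_reciprocal 2 (\<lambda>x. x)"
  by (simp add: self_reciprocal_def power2_eq_square)

lemma self_reciprocal_power:
  "self_reciprocal d f \<Longrightarrow> self_reciprocal (m * d) (\<lambda>x. f x ^ m)"
proof (induction m)
  case (Suc m)
  then show ?case using self_reciprocal_mult[of d f "m * d" "\<lambda>x. f x ^ m"] by simp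
qed (simp add: self_reciprocal_0_const)

lemma self_reciprocal_1_plus_X: "self_reciprocal 1 (\<lambda>x. 1 + x)"
  by (simp add: self_reciprocal_def distrib_left)

lemma self_reciprocal_scale: "self_reciprocal d f \<Longrightarrow> self_reciprocal d (\<lambda>x. c * f x)"
  using self_reciprocal_mult[OF self_reciprocal_0_const[of c], of d f] by simp

text \<open>The sum \<open>Z_sum\<close> of \<open>K\<^bsub>1,1,n\<^esub>\<close>. There are \<open>(n choose j) * 2 ^ j\<close> flats of rank \<open>j\<close> that do not link
  the two centres; the linking flats contribute the second summand.\<close>

definition thag_Z :: "nat \<Rightarrow> real \<Rightarrow> real" where
  "thag_Z n x = binomial_transform (2 * x) (\<lambda>k. poly (real_poly (thag_poly k)) x) n + x * (1 + x) ^ n"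

lemma self_reciprocal_binomial_transform_motzkin:
  "self_reciprocal n (\<lambda>x. binomial_transform (2 * x) (\<lambda>k. poly (real_poly (motzkin k)) x) n)"
  unfolding binomial_transform_motzkin
proof (rule self_reciprocal_sum)
  fix k
  show "self_reciprocal n (\<lambda>x. real ((n choose (2 * k)) * catalan k) * x ^ k * (2 * x + 2) ^ (n - 2 * k))"
  proof (cases "2 * k \<le> n")
    case True
    have "self_reciprocal 1 (\<lambda>x. 2 * x + 2)"
      using self_reciprocal_scale[OF self_reciprocal_1_plus_X, of 2] by (simp add: algebra_simps)
    then have "self_reciprocal (k * 2 + (n - 2 * k) * 1) (\<lambda>x. x ^ k * (2 * x + 2) ^ (n - 2 * k))"
      by (intro self_reciprocal_mult self_reciprocal_power self_reciprocal_X)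
    then show ?thesis using True self_reciprocal_scale
      by (simp add: mult.assoc mult.commute[of k])
  qed (simp add: binomial_eq_0 self_reciprocal_def)
qed

text \<open>A shift by \<open>2 * x\<close> turns the factor \<open>1 - x\<close> of the recurrence of \<open>thag_poly\<close> into \<open>1 + x\<close>, and the
  second summand of \<open>thag_Z\<close> satisfies the homogeneous recurrence.\<close>

lemma thag_Z_Suc:
  "thag_Z (Suc n) x = (1 + x) * thag_Z n x +
     x * binomial_transform (2 * x) (\<lambda>k. poly (real_poly (motzkin k)) x) n"
proof -
  have "binomial_transform (2 * x) (\<lambda>k. poly (real_poly (thag_poly (Suc k))) x) n =
      (1 - x) * binomial_transform (2 * x) (\<lambda>k. poly (real_poly (thag_poly k)) x) n +
      x * binomial_transform (2 * x) (\<lambda>k. poly (real_poly (motzkin k)) x) n"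
    unfolding poly_thag_Suc binomial_transform_def sum_distrib_left sum.distrib[symmetric]
    by (rule sum.cong) (simp_all add: algebra_simps)
  then show ?thesis
    unfolding thag_Z_def binomial_transform_Suc by (simp add: algebra_simps)
qed

lemma self_reciprocal_thag_Z: "self_reciprocal (Suc n) (thag_Z n)"
proof (induction n)
  case 0
  have "thag_Z 0 = (\<lambda>x. 1 + x)" by (simp add: fun_eq_iff thag_Z_def binomial_transform_def)
  then show ?case using self_reciprocal_1_plus_X by simp
next
  case (Suc n)
  have "self_reciprocal (1 + Suc n) (\<lambda>x. (1 + x) * thag_Z n x)"
    by (rule self_reciprocal_mult[OF self_reciprocal_1_plus_X Suc])
  moreover have "self_reciprocal (2 + n)
      (\<lambda>x. x * binomial_transform (2 * x) (\<lambda>k. poly (real_poly (motzkin k)) x) n)"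
    by (rule self_reciprocal_mult[OF self_reciprocal_X self_reciprocal_binomial_transform_motzkin])
  ultimately have "self_reciprocal (Suc (Suc n)) (\<lambda>x. (1 + x) * thag_Z n x +
      x * binomial_transform (2 * x) (\<lambda>k. poly (real_poly (motzkin k)) x) n)"
    by (intro self_reciprocal_add) simp_all
  then show ?case by (simp add: thag_Z_Suc fun_eq_iff flip: thag_Z_Suc)
qed

section \<open>The thagomizer matroid and its spineless variant\<close>

text \<open>The graphic matroid of \<open>K\<^bsub>1,1,n\<^esub>\<close>, known as the thagomizer graph, or of \<open>K\<^bsub>2,n\<^esub>\<close>, in terms of
  edges only: \<open>\<alpha> i\<close> and \<open>\<beta> i\<close> are the edges from the \<open>i\<close>-th leaf to the two centres, and \<open>\<epsilon>\<close> is
  the edge between the centres, which belongs to the matroid if \<open>spine\<close> holds. The cases with and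
  without spine are treated together because contracting any edge of the second kind of graph
  leads to the first.\<close>

locale thagomizer =
  fixes \<alpha> \<beta> :: "nat \<Rightarrow> 'e" and \<epsilon> :: 'e and n :: nat and spine :: bool
  assumes inj_\<alpha>: "inj_on \<alpha> {..<n}" and inj_\<beta>: "inj_on \<beta> {..<n}"
    and \<alpha>_\<beta>: "i < n \<Longrightarrow> j < n \<Longrightarrow> \<alpha> i \<noteq> \<beta> j"
    and \<epsilon>_\<alpha>: "i < n \<Longrightarrow> \<epsilon> \<noteq> \<alpha> i" and \<epsilon>_\<beta>: "i < n \<Longrightarrow> \<epsilon> \<noteq> \<beta> i"
    and n: "n \<ge> 2"
begin

definition edges :: "'e set" where
  "edges = \<alpha> ` {..<n} \<union> \<beta> ` {..<n} \<union> (if spine then {\<epsilon>} else {})"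

definition left_ends :: "'e set \<Rightarrow> nat set" where "left_ends X = {i. i < n \<and> \<alpha> i \<in> X}"
definition right_ends :: "'e set \<Rightarrow> nat set" where "right_ends X = {i. i < n \<and> \<beta> i \<in> X}"

text \<open>The number of paths of length one or two that join the two centres within \<open>X\<close>. A set is a forest
  exactly if there is at most one.\<close>

definition links :: "'e set \<Rightarrow> nat" where
  "links X = card (left_ends X \<inter> right_ends X) + (if \<epsilon> \<in> X then 1 else 0)"

definition thag_matroid :: "'e matroid" where
  "thag_matroid = Matroid edges {X. X \<subseteq> edges \<and> links X \<le> 1}"

text \<open>The rank function: a linked set has one redundant edge for each link after the first.\<close>

definition \<rho> :: "'e set \<Rightarrow> nat" where
  "\<rho> X = card (left_ends X \<union> right_ends X) + (if links X = 0 then 0 else 1)"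

lemma fin [simp]: "finite (left_ends X)" "finite (right_ends X)"
  by (simp_all add: left_ends_def right_ends_def)

lemma finite_edges: "finite edges"
  by (simp add: edges_def)

lemma ends_less: "i \<in> left_ends X \<Longrightarrow> i < n" "i \<in> right_ends X \<Longrightarrow> i < n"
  by (auto simp: left_ends_def right_ends_def)

lemma left_ends_insert [simp]:
  "i < n \<Longrightarrow> left_ends (insert (\<alpha> i) X) = insert i (left_ends X)"
  "i < n \<Longrightarrow> left_ends (insert (\<beta> i) X) = left_ends X"
  "left_ends (insert \<epsilon> X) = left_ends X"
proof -
  show "left_ends (insert \<epsilon> X) = left_ends X"
    unfolding left_ends_def by (rule Collect_cong) (metis \<epsilon>_\<alpha> insert_iff)
qed (use inj_\<alpha> \<alpha>_\<beta> in \<open>auto simp: left_ends_def inj_on_def\<close>)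

lemma right_ends_insert [simp]:
  "i < n \<Longrightarrow> right_ends (insert (\<beta> i) X) = insert i (right_ends X)"
  "i < n \<Longrightarrow> right_ends (insert (\<alpha> i) X) = right_ends X"
  "right_ends (insert \<epsilon> X) = right_ends X"
proof -
  show "right_ends (insert \<epsilon> X) = right_ends X"
    unfolding right_ends_def by (rule Collect_cong) (metis \<epsilon>_\<beta> insert_iff)
  show "right_ends (insert (\<alpha> i) X) = right_ends X" if "i < n"
    unfolding right_ends_def by (rule Collect_cong) (metis \<alpha>_\<beta> that insert_iff)
qed (use inj_\<beta> in \<open>auto simp: right_ends_def inj_on_def\<close>)

lemma edges_cases:
  assumes "e \<in> edges"
  obtains (alpha) i where "i < n" "e = \<alpha> i" | (beta) i where "i < n" "e = \<beta> i" | (eps) "spine" "e = \<epsilon>"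
  using assms by (auto simp: edges_def split: if_splits)

lemma decompose:
  assumes "X \<subseteq> edges"
  shows "X = \<alpha> ` left_ends X \<union> \<beta> ` right_ends X \<union> (X \<inter> {\<epsilon>})"
  using assms by (force simp: left_ends_def right_ends_def edges_def split: if_splits)

lemma card_eq:
  assumes "X \<subseteq> edges"
  shows "card X = card (left_ends X \<union> right_ends X) + links X"
proof -
  have "card X = card (\<alpha> ` left_ends X \<union> \<beta> ` right_ends X \<union> (X \<inter> {\<epsilon>}))"
    using decompose[OF assms] by simp
  also have "\<dots> = card (\<alpha> ` left_ends X) + card (\<beta> ` right_ends X) + card (X \<inter> {\<epsilon>})"
  proof -
    have "\<alpha> ` left_ends X \<inter> \<beta> ` right_ends X = {}" "(\<alpha> ` left_ends X \<union> \<beta> ` right_ends X) \<inter> (X \<inter> {\<epsilon>}) = {}"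
      using \<alpha>_\<beta> \<epsilon>_\<alpha> \<epsilon>_\<beta> ends_less by (auto dest: ends_less; metis ends_less)+
    then show ?thesis by (simp add: card_Un_disjoint)
  qed
  also have "card (\<alpha> ` left_ends X) = card (left_ends X)"
    by (rule card_image) (rule inj_on_subset[OF inj_\<alpha>], auto simp: left_ends_def)
  also have "card (\<beta> ` right_ends X) = card (right_ends X)"
    by (rule card_image) (rule inj_on_subset[OF inj_\<beta>], auto simp: right_ends_def)
  also have "card (X \<inter> {\<epsilon>}) = (if \<epsilon> \<in> X then 1 else 0)" by auto
  finally show ?thesis using card_Un_Int[of "left_ends X" "right_ends X"] by (simp add: links_def)
qed

lemma ends_mono: "X \<subseteq> Y \<Longrightarrow> left_ends X \<subseteq> left_ends Y" "X \<subseteq> Y \<Longrightarrow> right_ends X \<subseteq> right_ends Y"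
  by (auto simp: left_ends_def right_ends_def)

lemma links_mono: "X \<subseteq> Y \<Longrightarrow> links X \<le> links Y"
  unfolding links_def using ends_mono[of X Y] by (intro add_mono card_mono) auto

lemma links_eq_0: "links X = 0 \<longleftrightarrow> left_ends X \<inter> right_ends X = {} \<and> \<epsilon> \<notin> X"
  by (simp add: links_def)

lemma \<rho>_mono: "X \<subseteq> Y \<Longrightarrow> \<rho> X \<le> \<rho> Y"
  unfolding \<rho>_def using ends_mono[of X Y] links_mono[of X Y] by (intro add_mono card_mono) auto

lemma indeps_thag_matroid: "I \<in> indeps thag_matroid \<longleftrightarrow> I \<subseteq> edges \<and> links I \<le> 1"
  by (simp add: thag_matroid_def)

lemma ground_thag_matroid: "ground thag_matroid = edges"
  by (simp add: thag_matroid_def)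

lemma card_indep: "I \<in> indeps thag_matroid \<Longrightarrow> card I = \<rho> I"
  by (simp add: indeps_thag_matroid card_eq \<rho>_def)

text \<open>If \<open>J\<close> meets a leaf that \<open>I\<close> avoids, an edge at this leaf can be added without creating a link.
  Otherwise \<open>J\<close> is larger only because it is linked while \<open>I\<close> is not, and \<open>I\<close> can take over an edge
  of the link of \<open>J\<close>.\<close>

lemma exchange_thag_matroid:
  assumes I: "I \<in> indeps thag_matroid" and J: "J \<in> indeps thag_matroid" and less: "card I < card J"
  shows "\<exists>e\<in>J - I. insert e I \<in> indeps thag_matroid"
proof (cases "left_ends J \<union> right_ends J \<subseteq> left_ends I \<union> right_ends I")
  case False
  then obtain i where i: "i \<in> left_ends J \<union> right_ends J" "i \<notin> left_ends I" "i \<notin> right_ends I" by blast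
  then have "i < n" using ends_less by blast
  have l: "links (insert (\<alpha> i) I) = links I" "links (insert (\<beta> i) I) = links I"
    using i \<open>i < n\<close> \<epsilon>_\<alpha> \<epsilon>_\<beta> by (auto simp: links_def)
  from i(1) show ?thesis
  proof
    assume "i \<in> left_ends J"
    then show ?thesis using i l I \<open>i < n\<close>
      by (intro bexI[of _ "\<alpha> i"]) (auto simp: indeps_thag_matroid edges_def left_ends_def)
  next
    assume "i \<in> right_ends J"
    then show ?thesis using i l I \<open>i < n\<close>
      by (intro bexI[of _ "\<beta> i"]) (auto simp: indeps_thag_matroid edges_def right_ends_def)
  qed
next
  case True
  then have "card (left_ends J \<union> right_ends J) \<le> card (left_ends I \<union> right_ends I)" by (intro card_mono) auto
  then have lnk: "links I = 0" "links J \<noteq> 0"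
    using less I J by (auto simp: indeps_thag_matroid card_eq)
  show ?thesis
  proof (cases "\<epsilon> \<in> J")
    case True
    have "links (insert \<epsilon> I) \<le> 1" using lnk(1) by (simp add: links_def)
    then show ?thesis using True lnk(1) I J
      by (intro bexI[of _ \<epsilon>]) (auto simp: indeps_thag_matroid links_eq_0)
  next
    case False
    then obtain i where i: "i \<in> left_ends J" "i \<in> right_ends J" using lnk(2) by (auto simp: links_eq_0)
    then have "i < n" using ends_less by blast
    have J': "\<alpha> i \<in> J" "\<beta> i \<in> J" "\<alpha> i \<in> edges" "\<beta> i \<in> edges"
      using i J by (auto simp: left_ends_def right_ends_def indeps_thag_matroid)
    have "links (insert e I) \<le> 1" if "e = \<alpha> i \<or> e = \<beta> i" for e
    proof -
      have "left_ends (insert e I) \<inter> right_ends (insert e I) \<subseteq> {i}"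
        using that lnk(1) \<open>i < n\<close> by (auto simp: links_eq_0)
      then have "card (left_ends (insert e I) \<inter> right_ends (insert e I)) \<le> 1"
        using card_mono[of "{i}"] by fastforce
      moreover have "\<epsilon> \<notin> insert e I" using that lnk(1) \<epsilon>_\<alpha> \<epsilon>_\<beta> \<open>i < n\<close> by (auto simp: links_eq_0)
      ultimately show ?thesis by (simp add: links_def)
    qed
    then have ind: "insert (\<alpha> i) I \<in> indeps thag_matroid" "insert (\<beta> i) I \<in> indeps thag_matroid"
      using I J' by (auto simp: indeps_thag_matroid)
    have "i \<notin> left_ends I \<or> i \<notin> right_ends I" using lnk(1) by (auto simp: links_eq_0)
    then have "\<alpha> i \<notin> I \<or> \<beta> i \<notin> I" using \<open>i < n\<close> by (auto simp: left_ends_def right_ends_def)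
    then show ?thesis using ind J' by blast
  qed
qed

sublocale loopless_matroid thag_matroid
proof
  show "is_matroid thag_matroid"
    unfolding is_matroid_def
  proof (intro conjI ballI allI impI)
    show "indeps thag_matroid \<subseteq> Pow (ground thag_matroid)" by (auto simp: indeps_thag_matroid ground_thag_matroid)
    show "{} \<in> indeps thag_matroid" by (simp add: indeps_thag_matroid links_def left_ends_def)
    show "J \<in> indeps thag_matroid" if "I \<in> indeps thag_matroid" "J \<subseteq> I" for I J
      using that links_mono[of J I] by (auto simp: indeps_thag_matroid)
  qed (use exchange_thag_matroid in \<open>auto simp: ground_thag_matroid finite_edges\<close>)
  show "loopless thag_matroid"
    unfolding loopless_def
  proof
    fix e assume e: "e \<in> ground thag_matroid"
    then have "e \<in> edges" by (simp add: ground_thag_matroid)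
    then have "links {e} \<le> 1"
      by (cases rule: edges_cases) (simp_all add: links_def, auto simp: left_ends_def right_ends_def \<epsilon>_\<alpha> \<epsilon>_\<beta>)
    then show "{e} \<in> indeps thag_matroid" using \<open>e \<in> edges\<close> by (simp add: indeps_thag_matroid)
  qed
qed

text \<open>Keep one link and cut all the others at \<open>\<beta>\<close>; the index sets \<open>S\<close> of the edges removed differ
  according to whether \<open>\<epsilon>\<close> is the link that is kept.\<close>

lemma spanning_indep:
  assumes X: "X \<subseteq> edges"
  shows "\<exists>I\<in>indeps thag_matroid. I \<subseteq> X \<and> card I = \<rho> X"
proof -
  have AB: "left_ends (X - \<beta> ` S) = left_ends X" "right_ends (X - \<beta> ` S) = right_ends X - S" "(\<epsilon> \<in> X - \<beta> ` S) = (\<epsilon> \<in> X)"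
    if "S \<subseteq> {..<n}" for S
    using that \<alpha>_\<beta> \<epsilon>_\<beta> inj_\<beta> by (auto simp: left_ends_def right_ends_def inj_on_def) blast+
  have *: ?thesis if S: "S \<subseteq> left_ends X \<inter> right_ends X" 
    and l: "links (X - \<beta> ` S) = (if links X = 0 then 0 else 1)" for S
  proof -
    have Sn: "S \<subseteq> {..<n}" using S ends_less by blast
    have sub: "X - \<beta> ` S \<subseteq> edges" using X by auto
    have "left_ends X \<union> (right_ends X - S) = left_ends X \<union> right_ends X" using S by auto
    then have "card (X - \<beta> ` S) = \<rho> X"
      unfolding card_eq[OF sub] l \<rho>_def AB[OF Sn] by simp
    then show ?thesis using sub l by (intro bexI[of _ "X - \<beta> ` S"]) (auto simp: indeps_thag_matroid)
  qed
  show ?thesis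
  proof (cases "\<epsilon> \<in> X")
    case True
    have "left_ends X \<inter> right_ends X \<subseteq> {..<n}" using ends_less by blast
    then have "links (X - \<beta> ` (left_ends X \<inter> right_ends X)) = card (left_ends X \<inter> (right_ends X - left_ends X \<inter> right_ends X)) + 1"
      using True by (simp only: links_def AB if_True)
    also have "left_ends X \<inter> (right_ends X - left_ends X \<inter> right_ends X) = {}" by blast
    finally show ?thesis using True by (intro *[of "left_ends X \<inter> right_ends X"]) (simp_all add: links_def)
  next
    case False
    show ?thesis
    proof (cases "left_ends X \<inter> right_ends X = {}")
      case True
      then show ?thesis using False by (intro *[of "{}"]) (auto simp: links_def)
    next
      case ne: False
      then obtain i where i: "i \<in> left_ends X \<inter> right_ends X" by blast
      define S where "S = left_ends X \<inter> right_ends X - {i}"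
      have Sn: "S \<subseteq> {..<n}" unfolding S_def using ends_less by blast
      have "left_ends X \<inter> (right_ends X - S) = {i}" using i by (auto simp: S_def)
      then have "links (X - \<beta> ` S) = 1" using False Sn by (simp add: links_def AB)
      moreover have "links X \<noteq> 0" using ne by (auto simp: links_eq_0)
      ultimately show ?thesis by (intro *[of S]) (auto simp: S_def)
    qed
  qed
qed

lemma rank_thag_matroid: "X \<subseteq> edges \<Longrightarrow> rank_of thag_matroid X = \<rho> X"
  using spanning_indep[of X] rank_attained[of X] card_le_rank[of _ X] card_indep \<rho>_mono
  by (metis antisym)

lemma left_ends_edges: "left_ends edges = {..<n}" and right_ends_edges: "right_ends edges = {..<n}"
  by (auto simp: left_ends_def right_ends_def edges_def)

lemma links_edges: "links edges \<noteq> 0"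
  unfolding links_eq_0 left_ends_edges right_ends_edges using n by (auto simp: lessThan_empty_iff)

lemma rk_thag_matroid: "rk thag_matroid = n + 1"
  unfolding rk_def ground_thag_matroid using links_edges by (simp add: rank_thag_matroid \<rho>_def left_ends_edges right_ends_edges)

text \<open>Without a link every further edge raises the rank. With a link, a leaf that is joined to one
  centre is joined to both by the closure, and so are the centres to each other.\<close>

lemma flats_thag_matroid:
  "F \<in> flats thag_matroid \<longleftrightarrow> F \<subseteq> edges \<and> (links F = 0 \<or> left_ends F = right_ends F \<and> (spine \<longrightarrow> \<epsilon> \<in> F))"
proof -
  have "(\<forall>e\<in>edges - F. rank_of thag_matroid F < rank_of thag_matroid (insert e F)) \<longleftrightarrow>
      (links F = 0 \<or> left_ends F = right_ends F \<and> (spine \<longrightarrow> \<epsilon> \<in> F))" if F: "F \<subseteq> edges"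
  proof -
    have "(\<forall>e\<in>edges - F. rank_of thag_matroid F < rank_of thag_matroid (insert e F)) \<longleftrightarrow>
        (\<forall>e\<in>edges - F. \<rho> F < \<rho> (insert e F))"
      using F by (auto simp: rank_thag_matroid)
    also have "\<dots> \<longleftrightarrow> (links F = 0 \<or> left_ends F = right_ends F \<and> (spine \<longrightarrow> \<epsilon> \<in> F))"
    proof (cases "links F = 0")
      case True
      have "\<rho> F < \<rho> (insert e F)" if e: "e \<in> edges - F" for e
      proof -
        from e have "e \<in> edges" by simp
        then show ?thesis
        proof (cases rule: edges_cases)
          case (alpha i)
          then have "i \<notin> left_ends F" using e by (auto simp: left_ends_def)
          then show ?thesis using alpha True by (cases "i \<in> right_ends F") (auto simp: \<rho>_def links_eq_0 card_insert_if insert_absorb)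
        next
          case (beta i)
          then have "i \<notin> right_ends F" using e by (auto simp: right_ends_def)
          then show ?thesis using beta True by (cases "i \<in> left_ends F") (auto simp: \<rho>_def links_eq_0 card_insert_if insert_absorb)
        next
          case eps
          then show ?thesis using True by (auto simp: \<rho>_def links_eq_0)
        qed
      qed
      then show ?thesis using True by simp
    next
      case False
      have l: "links (insert e F) \<noteq> 0" for e
        using False links_mono[OF subset_insertI, of F e] by linarith
      have step: "\<rho> F < \<rho> (insert e F) \<longleftrightarrow> card (left_ends F \<union> right_ends F) < card (left_ends (insert e F) \<union> right_ends (insert e F))" for e
        using False l by (simp only: \<rho>_def if_False add_less_cancel_right)
      show ?thesis
      proof
        assume *: "\<forall>e\<in>edges - F. \<rho> F < \<rho> (insert e F)"
        have "i \<in> left_ends F \<longleftrightarrow> i \<in> right_ends F" for i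
        proof (rule ccontr)
          assume neq: "\<not> ?thesis"
          then have "i < n" using ends_less by blast
          from neq consider "i \<in> left_ends F" "i \<notin> right_ends F" | "i \<notin> left_ends F" "i \<in> right_ends F" by blast
          then show False
          proof cases
            case 1
            then have "\<beta> i \<in> edges - F" using \<open>i < n\<close> by (auto simp: right_ends_def edges_def)
            then have "card (left_ends F \<union> right_ends F) < card (left_ends (insert (\<beta> i) F) \<union> right_ends (insert (\<beta> i) F))" using * step by blast
            then show False using 1 \<open>i < n\<close> by (simp add: insert_absorb)
          next
            case 2
            then have "\<alpha> i \<in> edges - F" using \<open>i < n\<close> by (auto simp: left_ends_def edges_def)
            then have "card (left_ends F \<union> right_ends F) < card (left_ends (insert (\<alpha> i) F) \<union> right_ends (insert (\<alpha> i) F))" using * step by blast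
            then show False using 2 \<open>i < n\<close> by (simp add: insert_absorb)
          qed
        qed
        moreover have "\<epsilon> \<in> F" if spine
        proof (rule ccontr)
          assume "\<epsilon> \<notin> F"
          then have "\<epsilon> \<in> edges - F" using that unfolding edges_def by simp
          then have "card (left_ends F \<union> right_ends F) < card (left_ends (insert \<epsilon> F) \<union> right_ends (insert \<epsilon> F))" using * step by blast
          then show False by simp
        qed
        ultimately show "links F = 0 \<or> left_ends F = right_ends F \<and> (spine \<longrightarrow> \<epsilon> \<in> F)" by blast
      next
        assume "links F = 0 \<or> left_ends F = right_ends F \<and> (spine \<longrightarrow> \<epsilon> \<in> F)"
        with False have AB: "left_ends F = right_ends F" "spine \<longrightarrow> \<epsilon> \<in> F" by auto
        show "\<forall>e\<in>edges - F. \<rho> F < \<rho> (insert e F)"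
        proof
          fix e assume e: "e \<in> edges - F"
          then have "e \<in> edges" by simp
          then show "\<rho> F < \<rho> (insert e F)"
          proof (cases rule: edges_cases)
            case (alpha i)
            then have "i \<notin> left_ends F" using e by (auto simp: left_ends_def)
            then show ?thesis unfolding step using alpha AB(1) by (simp add: card_insert_if)
          next
            case (beta i)
            then have "i \<notin> right_ends F" using e by (auto simp: right_ends_def)
            then show ?thesis unfolding step using beta AB(1) by (simp add: card_insert_if)
          next
            case eps
            then show ?thesis using AB e by auto
          qed
        qed
      qed
    qed
    finally show ?thesis .
  qed
  then show ?thesis by (auto simp: flats_def is_flat_def ground_thag_matroid)
qed

lemma rank_flat: "F \<in> flats thag_matroid \<Longrightarrow> r F = \<rho> F"
  using flat_subset rank_thag_matroid by (auto simp: ground_thag_matroid)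

text \<open>The linked flat with leaf set \<open>S\<close>; without a spine, \<open>S = {}\<close> yields the empty set, which is not
  linked.\<close>

definition spanned :: "nat set \<Rightarrow> 'e set" where
  "spanned S = \<alpha> ` S \<union> \<beta> ` S \<union> (if spine then {\<epsilon>} else {})"

lemma ends_union_images:
  assumes "P \<subseteq> {..<n}" "Q \<subseteq> {..<n}"
  shows "left_ends (X \<union> \<alpha> ` P \<union> \<beta> ` Q) = left_ends X \<union> P" "right_ends (X \<union> \<alpha> ` P \<union> \<beta> ` Q) = right_ends X \<union> Q"
    "\<epsilon> \<in> X \<union> \<alpha> ` P \<union> \<beta> ` Q \<longleftrightarrow> \<epsilon> \<in> X"
proof -
  have a: "\<alpha> i \<in> X \<union> \<alpha> ` P \<union> \<beta> ` Q \<longleftrightarrow> \<alpha> i \<in> X \<or> i \<in> P" if "i < n" for i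
    using that assms inj_\<alpha> \<alpha>_\<beta> by (auto simp: inj_on_def)
  have b: "\<beta> i \<in> X \<union> \<alpha> ` P \<union> \<beta> ` Q \<longleftrightarrow> \<beta> i \<in> X \<or> i \<in> Q" if "i < n" for i
    using that assms inj_\<beta> \<alpha>_\<beta> by (auto simp: inj_on_def) (metis lessThan_iff subsetD)+
  show "left_ends (X \<union> \<alpha> ` P \<union> \<beta> ` Q) = left_ends X \<union> P" using a assms by (auto simp: left_ends_def)
  show "right_ends (X \<union> \<alpha> ` P \<union> \<beta> ` Q) = right_ends X \<union> Q" using b assms by (auto simp: right_ends_def)
  show "\<epsilon> \<in> X \<union> \<alpha> ` P \<union> \<beta> ` Q \<longleftrightarrow> \<epsilon> \<in> X"
    using assms \<epsilon>_\<alpha> \<epsilon>_\<beta> by (auto dest: subsetD)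
qed

lemma spanned_simps:
  assumes "S \<subseteq> {..<n}"
  shows "left_ends (spanned S) = S" "right_ends (spanned S) = S" "\<epsilon> \<in> spanned S \<longleftrightarrow> spine" "spanned S \<subseteq> edges"
proof -
  have eq: "spanned S = (if spine then {\<epsilon>} else {}) \<union> \<alpha> ` S \<union> \<beta> ` S" by (auto simp: spanned_def)
  have e: "left_ends (if spine then {\<epsilon>} else {}) = {}" "right_ends (if spine then {\<epsilon>} else {}) = {}"
    using \<epsilon>_\<alpha> \<epsilon>_\<beta> by (auto simp: left_ends_def right_ends_def)
  show "left_ends (spanned S) = S" "right_ends (spanned S) = S" "\<epsilon> \<in> spanned S \<longleftrightarrow> spine"
    unfolding eq ends_union_images[OF assms assms] e by auto
  show "spanned S \<subseteq> edges" using assms by (auto simp: spanned_def edges_def)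
qed

lemma eq_if_same_ends:
  assumes "X \<subseteq> edges" "Y \<subseteq> edges" "left_ends X = left_ends Y" "right_ends X = right_ends Y" "\<epsilon> \<in> X \<longleftrightarrow> \<epsilon> \<in> Y"
  shows "X = Y"
proof -
  have "X = \<alpha> ` left_ends X \<union> \<beta> ` right_ends X \<union> (X \<inter> {\<epsilon>})" by (rule decompose[OF assms(1)])
  also have "\<dots> = \<alpha> ` left_ends Y \<union> \<beta> ` right_ends Y \<union> (Y \<inter> {\<epsilon>})" using assms by auto
  also have "\<dots> = Y" by (rule decompose[OF assms(2), symmetric])
  finally show ?thesis .
qed

lemma subset_if_ends_subset:
  assumes "X \<subseteq> edges" "left_ends X \<subseteq> left_ends Y" "right_ends X \<subseteq> right_ends Y" "\<epsilon> \<in> X \<Longrightarrow> \<epsilon> \<in> Y"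
  shows "X \<subseteq> Y"
  using assms by (force elim!: edges_cases simp: left_ends_def right_ends_def)

lemma spine_if_\<epsilon>: "X \<subseteq> edges \<Longrightarrow> \<epsilon> \<in> X \<Longrightarrow> spine"
proof -
  assume "X \<subseteq> edges" "\<epsilon> \<in> X"
  then have "\<epsilon> \<in> edges" by blast
  then show spine
    by (cases rule: edges_cases) (use \<epsilon>_\<alpha> \<epsilon>_\<beta> in blast)+
qed

lemma linked_flats_above:
  assumes F: "F \<subseteq> edges"
  defines "C \<equiv> left_ends F \<union> right_ends F"
  shows "{G \<in> flats thag_matroid. F \<subseteq> G \<and> links G \<noteq> 0} =
    (\<lambda>S. spanned (C \<union> S)) ` {S \<in> Pow ({..<n} - C). spine \<or> C \<union> S \<noteq> {}}"
proof (intro equalityI subsetI)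
  fix G assume "G \<in> {G \<in> flats thag_matroid. F \<subseteq> G \<and> links G \<noteq> 0}"
  then have G: "G \<subseteq> edges" "left_ends G = right_ends G" "spine \<longrightarrow> \<epsilon> \<in> G" "F \<subseteq> G" "links G \<noteq> 0"
    by (auto simp: flats_thag_matroid)
  have An: "left_ends G \<subseteq> {..<n}" using ends_less by blast
  have CG: "C \<subseteq> left_ends G" using ends_mono[OF G(4)] G(2) by (auto simp: C_def)
  have "\<epsilon> \<in> G \<longleftrightarrow> spine" using G spine_if_\<epsilon> by blast
  then have "G = spanned (left_ends G)"
    by (intro eq_if_same_ends) (use G(1,2) spanned_simps[OF An] in auto)
  moreover have "spine \<or> left_ends G \<noteq> {}" using G(2,5) \<open>\<epsilon> \<in> G \<longleftrightarrow> spine\<close> by (auto simp: links_eq_0)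
  moreover have "C \<union> (left_ends G - C) = left_ends G" using CG by auto
  ultimately show "G \<in> (\<lambda>S. spanned (C \<union> S)) ` {S \<in> Pow ({..<n} - C). spine \<or> C \<union> S \<noteq> {}}"
    using An by (intro image_eqI[of _ _ "left_ends G - C"]) auto
next
  fix G assume "G \<in> (\<lambda>S. spanned (C \<union> S)) ` {S \<in> Pow ({..<n} - C). spine \<or> C \<union> S \<noteq> {}}"
  then obtain S where S: "S \<subseteq> {..<n} - C" "spine \<or> C \<union> S \<noteq> {}" "G = spanned (C \<union> S)" by auto
  have CS: "C \<union> S \<subseteq> {..<n}" using S(1) ends_less by (auto simp: C_def)
  note sp = spanned_simps[OF CS, folded S(3)]
  have "F \<subseteq> G"
    by (rule subset_if_ends_subset[OF F]) (use sp spine_if_\<epsilon>[OF F] in \<open>auto simp: C_def\<close>)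
  moreover have "links G \<noteq> 0" using S(2) sp by (auto simp: links_eq_0)
  ultimately show "G \<in> {G \<in> flats thag_matroid. F \<subseteq> G \<and> links G \<noteq> 0}" using sp by (simp add: flats_thag_matroid)
qed

lemma sum_linked_flats_above:
  fixes g :: "nat \<Rightarrow> real"
  assumes F: "F \<subseteq> edges"
  defines "C \<equiv> left_ends F \<union> right_ends F"
  shows "(\<Sum>G\<in>{G \<in> flats thag_matroid. F \<subseteq> G \<and> links G \<noteq> 0}. g (\<rho> G)) =
    (\<Sum>S\<in>{S \<in> Pow ({..<n} - C). spine \<or> C \<union> S \<noteq> {}}. g (card C + card S + 1))"
proof -
  let ?I = "{S \<in> Pow ({..<n} - C). spine \<or> C \<union> S \<noteq> {}}"
  have CS: "C \<union> S \<subseteq> {..<n}" if "S \<in> ?I" for S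
    using that ends_less by (auto simp: C_def)
  have inj: "inj_on (\<lambda>S. spanned (C \<union> S)) ?I"
  proof (rule inj_onI)
    fix S S' assume S: "S \<in> ?I" "S' \<in> ?I" "spanned (C \<union> S) = spanned (C \<union> S')"
    have "C \<union> S = left_ends (spanned (C \<union> S))" "C \<union> S' = left_ends (spanned (C \<union> S'))"
      using spanned_simps(1)[OF CS[OF S(1)]] spanned_simps(1)[OF CS[OF S(2)]] by (simp_all only:)
    with S(3) have "C \<union> S = C \<union> S'" by (simp only:)
    then show "S = S'" using S(1,2) by blast
  qed
  have "\<rho> (spanned (C \<union> S)) = card C + card S + 1" if S: "S \<in> ?I" for S
  proof -
    note sp = spanned_simps[OF CS[OF S]]
    have "finite S" "C \<inter> S = {}" using S finite_subset by auto
    then have "card (C \<union> S) = card C + card S" by (simp add: card_Un_disjoint C_def)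
    moreover have "links (spanned (C \<union> S)) \<noteq> 0" using S sp by (auto simp: links_eq_0)
    ultimately show ?thesis by (simp add: \<rho>_def sp)
  qed
  then show ?thesis
    unfolding linked_flats_above[OF F, folded C_def] by (subst sum.reindex[OF inj]) simp
qed

text \<open>An unlinked flat above \<open>F\<close> arises by choosing a set \<open>S\<close> of new leaves and a subset \<open>P\<close> of \<open>S\<close>
  of those joined to the first centre. The flat has \<open>card S\<close> new edges, whatever \<open>P\<close> is.\<close>

lemma sum_unlinked_flats_above:
  fixes g :: "nat \<Rightarrow> real"
  assumes F: "F \<subseteq> edges" "links F = 0"
  defines "U \<equiv> {..<n} - (left_ends F \<union> right_ends F)"
  shows "(\<Sum>G\<in>{G \<in> flats thag_matroid. F \<subseteq> G \<and> links G = 0}. g (card G)) =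
    (\<Sum>S\<in>Pow U. 2 ^ card S * g (card F + card S))"
proof -
  define C where "C = left_ends F \<union> right_ends F"
  let ?\<phi> = "\<lambda>(S, P). F \<union> \<alpha> ` P \<union> \<beta> ` (S - P)"
  have finU: "finite U" by (simp add: U_def)
  have \<phi>: "left_ends (F \<union> \<alpha> ` P \<union> \<beta> ` (S - P)) = left_ends F \<union> P" "right_ends (F \<union> \<alpha> ` P \<union> \<beta> ` (S - P)) = right_ends F \<union> (S - P)"
      "links (F \<union> \<alpha> ` P \<union> \<beta> ` (S - P)) = 0" "F \<union> \<alpha> ` P \<union> \<beta> ` (S - P) \<subseteq> edges"
      "card (F \<union> \<alpha> ` P \<union> \<beta> ` (S - P)) = card F + card S"
    if "S \<subseteq> U" "P \<subseteq> S" for S P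
  proof -
    have sub: "P \<subseteq> {..<n}" "S - P \<subseteq> {..<n}" using that by (auto simp: U_def)
    note AB = ends_union_images[OF sub, of F]
    show AF: "left_ends (F \<union> \<alpha> ` P \<union> \<beta> ` (S - P)) = left_ends F \<union> P" and BF: "right_ends (F \<union> \<alpha> ` P \<union> \<beta> ` (S - P)) = right_ends F \<union> (S - P)"
      by (fact AB)+
    show l: "links (F \<union> \<alpha> ` P \<union> \<beta> ` (S - P)) = 0"
      unfolding links_eq_0 AB using F(2) that by (auto simp: links_eq_0 U_def)
    show e: "F \<union> \<alpha> ` P \<union> \<beta> ` (S - P) \<subseteq> edges" using F(1) sub by (auto simp: edges_def)
    have "card (left_ends F \<union> P \<union> (right_ends F \<union> (S - P))) = card (left_ends F \<union> right_ends F \<union> S)"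
      by (rule arg_cong[of _ _ card]) (use that in auto)
    also have "\<dots> = card (left_ends F \<union> right_ends F) + card S"
      using that finite_subset[OF that(1) finU] by (intro card_Un_disjoint) (auto simp: U_def)
    finally show "card (F \<union> \<alpha> ` P \<union> \<beta> ` (S - P)) = card F + card S"
      unfolding card_eq[OF e] card_eq[OF F(1)] AF BF l F(2) by simp
  qed
  have "(\<Sum>G\<in>{G \<in> flats thag_matroid. F \<subseteq> G \<and> links G = 0}. g (card G)) =
      (\<Sum>(S, P)\<in>(SIGMA S:Pow U. Pow S). g (card F + card S))"
  proof (rule sum.reindex_bij_witness[where i = ?\<phi> and j = "\<lambda>G. ((left_ends G \<union> right_ends G) - C, left_ends G - C)"], goal_cases)
    case (1 G)
    then have G: "G \<subseteq> edges" "F \<subseteq> G" "links G = 0" by (auto simp: flats_thag_matroid)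
    let ?S = "left_ends G \<union> right_ends G - C" and ?P = "left_ends G - C"
    have S: "?S \<subseteq> U" using ends_less by (auto simp: U_def C_def)
    have "?P \<subseteq> ?S" by blast
    note \<phi>' = \<phi>[OF S this]
    have "left_ends F \<union> ?P = left_ends G" "right_ends F \<union> (?S - ?P) = right_ends G"
      using ends_mono[OF G(2)] G(3) by (auto simp: C_def links_eq_0)
    then have "F \<union> \<alpha> ` ?P \<union> \<beta> ` (?S - ?P) = G"
      using \<phi>' G by (intro eq_if_same_ends) (auto simp: links_eq_0)
    then show ?case by simp
  next
    case (2 G)
    then show ?case using ends_less by (auto simp: U_def C_def)
  next
    case (3 SP)
    then obtain S P where SP: "SP = (S, P)" "S \<subseteq> U" "P \<subseteq> S" by auto
    have "left_ends F \<union> P \<union> (right_ends F \<union> (S - P)) - C = S" "left_ends F \<union> P - C = P"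
      using SP(2,3) by (auto simp: U_def C_def)
    then show ?case unfolding SP(1) using \<phi>(1,2)[OF SP(2,3)] by simp
  next
    case (4 SP)
    then obtain S P where SP: "SP = (S, P)" "S \<subseteq> U" "P \<subseteq> S" by auto
    then show ?case using \<phi>(3,4)[OF SP(2,3)] by (auto simp: flats_thag_matroid)
  next
    case (5 G)
    then have G: "G \<subseteq> edges" "F \<subseteq> G" "links G = 0" by (auto simp: flats_thag_matroid)
    have "card G = card (left_ends G \<union> right_ends G)" using card_eq[OF G(1)] G(3) by simp
    also have "left_ends G \<union> right_ends G = C \<union> (left_ends G \<union> right_ends G - C)" using ends_mono[OF G(2)] by (auto simp: C_def)
    also have "card \<dots> = card C + card (left_ends G \<union> right_ends G - C)"
      by (rule card_Un_disjoint) (auto simp: C_def)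
    also have "card C = card F" using card_eq[OF F(1)] F(2) by (simp add: C_def)
    finally show ?case by simp
  qed
  also have "\<dots> = (\<Sum>S\<in>Pow U. \<Sum>P\<in>Pow S. g (card F + card S))"
    by (rule sum.Sigma[symmetric]) (use finU finite_subset in auto)
  also have "\<dots> = (\<Sum>S\<in>Pow U. 2 ^ card S * g (card F + card S))"
    by (rule sum.cong) (use finite_subset[OF _ finU] in \<open>auto simp: card_Pow\<close>)
  finally show ?thesis .
qed

text \<open>The Kazhdan--Lusztig polynomial of the contraction by \<open>F\<close>: Boolean up to parallel edges if \<open>F\<close> is
  linked, otherwise a thagomizer matroid with \<open>n - card F\<close> leaves up to parallel edges. A missing
  spine is only visible for \<open>F = {}\<close>, since any contracted edge turns its partner into a spine.\<close>

definition KL_flat :: "'e set \<Rightarrow> int poly" where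
  "KL_flat F = (if links F \<noteq> 0 then 1 else
     thag_poly (n - card F) + (if F = {} \<and> \<not> spine then [:0, 1:] else 0))"

text \<open>The flats above form a Boolean lattice and all contribute the polynomial \<open>1\<close>, so the sum is a power
  of \<open>1 + x\<close>.\<close>

lemma self_reciprocal_linked:
  assumes F: "F \<in> flats thag_matroid" "links F \<noteq> 0"
  shows "self_reciprocal (rk thag_matroid - r F)
    (\<lambda>x. \<Sum>G\<in>{G \<in> flats thag_matroid. F \<subseteq> G}. x ^ (r G - r F) * poly (real_poly (KL_flat G)) x)"
proof -
  define C where "C = left_ends F \<union> right_ends F"
  have FE: "F \<subseteq> edges" using F by (simp add: flats_thag_matroid)
  have rF: "r F = card C + 1" using rank_flat[OF F(1)] F(2) by (simp add: \<rho>_def C_def)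
  have Cn: "C \<subseteq> {..<n}" using ends_less by (auto simp: C_def)
  have l: "links G \<noteq> 0" if "F \<subseteq> G" for G using F(2) links_mono[OF that] by simp
  then have set: "{G \<in> flats thag_matroid. F \<subseteq> G} = {G \<in> flats thag_matroid. F \<subseteq> G \<and> links G \<noteq> 0}" by auto
  have all: "{S \<in> Pow ({..<n} - C). spine \<or> C \<union> S \<noteq> {}} = Pow ({..<n} - C)"
    using F(2) spine_if_\<epsilon>[OF FE] by (auto simp: C_def links_eq_0)
  have "(\<Sum>G\<in>{G \<in> flats thag_matroid. F \<subseteq> G}. x ^ (r G - r F) * poly (real_poly (KL_flat G)) x) =
      (1 + x) ^ card ({..<n} - C)" for x :: real
  proof -
    have "(\<Sum>G\<in>{G \<in> flats thag_matroid. F \<subseteq> G}. x ^ (r G - r F) * poly (real_poly (KL_flat G)) x) =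
        (\<Sum>G\<in>{G \<in> flats thag_matroid. F \<subseteq> G \<and> links G \<noteq> 0}. x ^ (\<rho> G - r F))"
      unfolding set by (rule sum.cong) (auto simp: rank_flat KL_flat_def)
    also have "\<dots> = (\<Sum>S\<in>Pow ({..<n} - C). x ^ card S)"
      using sum_linked_flats_above[OF FE, of "\<lambda>k. x ^ (k - r F)"]
      unfolding C_def[symmetric] all rF by simp
    also have "\<dots> = (1 + x) ^ card ({..<n} - C)" by (rule sum_Pow_power_card) simp
    finally show ?thesis .
  qed
  moreover have "card ({..<n} - C) = rk thag_matroid - r F"
    using card_Diff_subset[of C "{..<n}"] Cn finite_subset[OF Cn] by (simp add: rk_thag_matroid rF)
  moreover have "self_reciprocal (rk thag_matroid - r F) (\<lambda>x. (1 + x) ^ (rk thag_matroid - r F))"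
    using self_reciprocal_power[OF self_reciprocal_1_plus_X] by simp
  ultimately show ?thesis by simp
qed

text \<open>With \<open>m\<close> remaining leaves the sum is \<open>thag_Z m\<close>. For \<open>F = {}\<close> and no spine, the flat consisting of
  the spine is missing among the linked flats and costs \<open>x\<close>, which the extra summand \<open>x\<close> of
  \<open>KL_flat {}\<close> compensates.\<close>

lemma self_reciprocal_unlinked:
  assumes F: "F \<in> flats thag_matroid" "links F = 0"
  shows "self_reciprocal (rk thag_matroid - r F)
    (\<lambda>x. \<Sum>G\<in>{G \<in> flats thag_matroid. F \<subseteq> G}. x ^ (r G - r F) * poly (real_poly (KL_flat G)) x)"
proof -
  define C where "C = left_ends F \<union> right_ends F"
  define U where "U = {..<n} - C"
  define m where "m = card U"
  have FE: "F \<subseteq> edges" using F by (simp add: flats_thag_matroid)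
  have cF: "card F = card C" using card_eq[OF FE] F(2) by (simp add: C_def)
  have rF: "r F = card F" using rank_flat[OF F(1)] F(2) cF by (simp add: \<rho>_def C_def)
  have Cn: "C \<subseteq> {..<n}" using ends_less by (auto simp: C_def)
  have m: "m = n - card F" "card F \<le> n"
    using card_Diff_subset[of C "{..<n}"] card_mono[OF _ Cn] Cn finite_subset[OF Cn]
    by (simp_all add: m_def U_def cF)
  have finU: "finite U" by (simp add: U_def)
  have Cempty: "C = {} \<longleftrightarrow> F = {}"
    using eq_if_same_ends[OF FE, of "{}"] F(2) by (auto simp: C_def left_ends_def right_ends_def links_eq_0)
  let ?L = "{G \<in> flats thag_matroid. F \<subseteq> G \<and> links G \<noteq> 0}" and ?N = "{G \<in> flats thag_matroid. F \<subseteq> G \<and> links G = 0}"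
  have "(\<Sum>G\<in>{G \<in> flats thag_matroid. F \<subseteq> G}. x ^ (r G - r F) * poly (real_poly (KL_flat G)) x) = thag_Z m x"
    (is "sum ?h _ = _") for x :: real
  proof -
    \<comment> \<open>The contribution of the flat consisting of the spine, when it is missing.\<close>
    define e where "e = (if F = {} \<and> \<not> spine then x else 0)"
    have "sum ?h {G \<in> flats thag_matroid. F \<subseteq> G} = sum ?h ?L + sum ?h ?N"
    proof -
      have "{G \<in> flats thag_matroid. F \<subseteq> G} = ?L \<union> ?N" by auto
      then show ?thesis using finite_flats by (simp only:) (rule sum.union_disjoint; auto)
    qed
    also have "sum ?h ?L = x * (1 + x) ^ m - e"
    proof -
      have "sum ?h ?L = (\<Sum>G\<in>?L. x ^ (\<rho> G - card F))"
        by (rule sum.cong) (auto simp: rank_flat[symmetric] rF KL_flat_def)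
      also have "\<dots> = (\<Sum>S\<in>{S \<in> Pow U. spine \<or> C \<union> S \<noteq> {}}. x ^ (card S + 1))"
        using sum_linked_flats_above[OF FE, of "\<lambda>k. x ^ (k - card F)"]
        by (simp add: C_def[symmetric] U_def[symmetric] cF)
      also have "\<dots> = (\<Sum>S\<in>Pow U. x ^ (card S + 1)) - e"
      proof (cases "F = {} \<and> \<not> spine")
        case True
        then have "{S \<in> Pow U. spine \<or> C \<union> S \<noteq> {}} = Pow U - {{}}" using Cempty by auto
        then show ?thesis using True finU by (simp add: e_def sum_diff1)
      next
        case False
        then have "{S \<in> Pow U. spine \<or> C \<union> S \<noteq> {}} = Pow U" using Cempty by auto
        moreover have "e = 0" using False by (simp only: e_def if_False)
        ultimately show ?thesis by (simp only: diff_zero)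
      qed
      also have "(\<Sum>S\<in>Pow U. x ^ (card S + 1)) = x * (1 + x) ^ m"
        by (simp add: sum_Pow_power_card[OF finU] m_def flip: sum_distrib_left)
      finally show ?thesis .
    qed
    also have "sum ?h ?N = binomial_transform (2 * x) (\<lambda>k. poly (real_poly (thag_poly k)) x) m + e"
    proof -
      have "sum ?h ?N = (\<Sum>G\<in>?N. x ^ (card G - card F) * poly (real_poly (thag_poly (n - card G))) x +
          (if G = {} then e else 0))"
      proof (rule sum.cong)
        fix G assume "G \<in> ?N"
        then have G: "G \<in> flats thag_matroid" "F \<subseteq> G" "links G = 0" "G \<subseteq> edges" by (auto simp: flats_thag_matroid)
        have "r G = card G" using rank_flat[OF G(1)] card_eq[OF G(4)] G(3) by (simp add: \<rho>_def)
        then show "?h G = x ^ (card G - card F) * poly (real_poly (thag_poly (n - card G))) x +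
            (if G = {} then e else 0)"
          using G(2,3) by (auto simp: KL_flat_def rF e_def map_poly_of_int_simps)
      qed simp
      also have "\<dots> = (\<Sum>G\<in>?N. x ^ (card G - card F) * poly (real_poly (thag_poly (n - card G))) x) +
          (\<Sum>G\<in>?N. if G = {} then e else 0)"
        by (rule sum.distrib)
      also have "(\<Sum>G\<in>?N. if G = {} then e else 0) = e"
        using finite_flats F by (auto simp: e_def)
      also have "(\<Sum>G\<in>?N. x ^ (card G - card F) * poly (real_poly (thag_poly (n - card G))) x) =
          (\<Sum>S\<in>Pow U. 2 ^ card S * (x ^ card S * poly (real_poly (thag_poly (m - card S))) x))"
        using sum_unlinked_flats_above[OF FE F(2),
            of "\<lambda>k. x ^ (k - card F) * poly (real_poly (thag_poly (n - k))) x"]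
        by (simp add: C_def[symmetric] U_def[symmetric] m)
      also have "\<dots> = (\<Sum>j\<le>m. real (m choose j) * (2 ^ j * (x ^ j * poly (real_poly (thag_poly (m - j))) x)))"
        unfolding m_def by (rule sum_Pow_card[OF finU])
      also have "\<dots> = binomial_transform (2 * x) (\<lambda>k. poly (real_poly (thag_poly k)) x) m"
        by (simp add: binomial_transform_def power_mult_distrib mult.assoc)
      finally show ?thesis .
    qed
    finally show ?thesis by (simp add: thag_Z_def)
  qed
  moreover have "rk thag_matroid - r F = Suc m" using m by (simp add: rk_thag_matroid rF)
  ultimately show ?thesis using self_reciprocal_thag_Z[of m] by simp
qed

theorem KL_poly_thag_matroid: "KL_poly thag_matroid = thag_poly n + (if spine then 0 else [:0, 1:])"
proof -
  have "KL_poly thag_matroid = KL_flat {}"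
  proof (rule KL_poly_eqI)
    show "KL_flat (ground thag_matroid) = 1" by (simp add: KL_flat_def ground_thag_matroid links_edges)
    show "2 * degree (KL_flat F) < rk thag_matroid - r F" if F: "F \<in> flats thag_matroid" "F \<noteq> ground thag_matroid" for F
    proof (cases "links F = 0")
      case False
      have "r F < rk thag_matroid" unfolding rk_def
        using F flat_subset[of F] by (intro flat_rank_strict_mono) auto
      then show ?thesis using False by (simp add: KL_flat_def)
    next
      case True
      have FE: "F \<subseteq> edges" using F by (simp add: flats_thag_matroid)
      have "r F = card F" using rank_flat[OF F(1)] card_eq[OF FE] True by (simp add: \<rho>_def)
      moreover have "card (left_ends F \<union> right_ends F) \<le> card {..<n}" using ends_less by (intro card_mono) auto
      then have "card F \<le> n" using card_eq[OF FE] True by simp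
      moreover have "degree (KL_flat F) = (n - card F) div 2"
        using True thag_plus_X_top(1)[OF n] by (auto simp: KL_flat_def degree_thag)
      ultimately show ?thesis by (simp add: rk_thag_matroid)
    qed
    show "self_reciprocal (rk thag_matroid - r F)
        (\<lambda>x. \<Sum>G\<in>{G \<in> flats thag_matroid. F \<subseteq> G}. x ^ (r G - r F) * poly (real_poly (KL_flat G)) x)"
      if "F \<in> flats thag_matroid" for F
      using that self_reciprocal_linked self_reciprocal_unlinked by blast
  qed
  also have "\<dots> = thag_poly n + (if spine then 0 else [:0, 1:])"
    by (simp add: KL_flat_def links_def left_ends_def)
  finally show ?thesis .
qed

end

locale thagomizer_graph =
  fixes a b :: 'v and c :: "nat \<Rightarrow> 'v" and n :: nat and spine :: bool
  assumes a_b: "a \<noteq> b" and inj_c: "inj_on c {..<n}"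
    and c_a: "i < n \<Longrightarrow> c i \<noteq> a" and c_b: "i < n \<Longrightarrow> c i \<noteq> b" and n_ge_2: "n \<ge> 2"
begin

sublocale thagomizer "\<lambda>i. {a, c i}" "\<lambda>i. {b, c i}" "{a, b}" n spine
  by unfold_locales
    (use a_b inj_c c_a c_b n_ge_2 in \<open>auto simp: inj_on_def doubleton_eq_iff\<close>)

lemma edges_doubleton:
  assumes "{u, v} \<in> edges"
  shows "u \<in> {a, b} \<or> (\<exists>i<n. u = c i)"
  using assms by (auto simp: edges_def doubleton_eq_iff split: if_splits)

lemma neighbour_of_c:
  assumes "X \<subseteq> edges" "{c i, v} \<in> X" "i < n"
  shows "v = a \<and> i \<in> left_ends X \<or> v = b \<and> i \<in> right_ends X"
proof -
  have "{c i, v} \<in> edges" using assms by blast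
  then have "v = a \<or> v = b"
    using c_a[OF assms(3)] c_b[OF assms(3)] c_a c_b
    by (auto simp: edges_def doubleton_eq_iff split: if_splits)
  then show ?thesis using assms by (auto simp: left_ends_def right_ends_def insert_commute)
qed

lemma cycle_if_two_links:
  assumes "2 \<le> links X"
  shows "\<exists>vs. is_cycle X vs"
proof (cases "{a, b} \<in> X")
  case True
  then have "left_ends X \<inter> right_ends X \<noteq> {}" using assms by (auto simp: links_def)
  then obtain i where "i \<in> left_ends X" "i \<in> right_ends X" by blast
  then have "is_cycle X [a, c i, b]"
    using True a_b c_a[of i] c_b[of i]
    by (auto simp: is_cycle_def All_less_Suc left_ends_def right_ends_def insert_commute)
  then show ?thesis by blast
next
  case False
  then have "\<not> card (left_ends X \<inter> right_ends X) \<le> Suc 0" using assms by (simp add: links_def)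
  then obtain i j where ij: "i \<in> left_ends X \<inter> right_ends X" "j \<in> left_ends X \<inter> right_ends X" "i \<noteq> j"
    by (auto simp: card_le_Suc0_iff_eq)
  then have "c i \<noteq> c j" using inj_c ends_less by (auto simp: inj_on_def)
  then have "is_cycle X [a, c i, b, c j]"
    using ij a_b c_a[of i] c_b[of i] c_a[of j] c_b[of j]
    by (auto simp: is_cycle_def All_less_Suc left_ends_def right_ends_def insert_commute)
  then show ?thesis by blast
qed

text \<open>Indexing the cycle cyclically, take a leaf on it: its two neighbours are the two centres, which is
  one link. The vertex after the second centre is either the first centre, so that the spine is a
  link, or another leaf, whose neighbours are again the two centres.\<close>

lemma two_links_if_cycle:
  assumes X: "X \<subseteq> edges" and cyc: "is_cycle X vs"
  shows "2 \<le> links X"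
proof -
  define m where "m = length vs"
  \<comment> \<open>Indices run over all naturals, so that predecessors need no case distinction.\<close>
  define g where "g k = vs ! (k mod m)" for k
  have m: "m \<ge> 3" and dist: "distinct vs"
    and adj0: "\<And>i. i < m \<Longrightarrow> {vs ! i, vs ! (Suc i mod m)} \<in> X"
    using cyc by (auto simp: is_cycle_def m_def)
  have adj: "{g k, g (Suc k)} \<in> X" for k
    using adj0[of "k mod m"] m by (simp add: g_def mod_Suc_eq)
  have index: "k mod m < length vs" for k
    using m unfolding m_def by (intro mod_less_divisor) linarith
  have neq: "g k \<noteq> g (k + d)" if "0 < d" "d < m" for k d
  proof
    assume "g k = g (k + d)"
    then have "k mod m = (k + d) mod m"
      using nth_eq_iff_index_eq[OF dist index index] by (simp add: g_def)
    then have "m dvd d" using mod_eq_dvd_iff_nat[of k "k + d" m] by simp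
    then show False using that by (auto dest: dvd_imp_le)
  qed
  have vertex: "g k \<in> {a, b} \<or> (\<exists>i<n. g k = c i)" for k
    using adj[of k] X edges_doubleton by blast
  obtain k where k: "g (Suc k) \<notin> {a, b}"
  proof -
    have "g 1 \<noteq> g 2" "g 2 \<noteq> g 3" "g 1 \<noteq> g 3"
      using neq[of 1 1] neq[of 1 2] neq[of 2 1] m by (simp_all add: numeral_eq_Suc)
    then have "g (Suc 0) \<notin> {a, b} \<or> g (Suc 1) \<notin> {a, b} \<or> g (Suc 2) \<notin> {a, b}"
      by (auto simp: numeral_eq_Suc)
    then show ?thesis using that by blast
  qed
  then obtain i where i: "i < n" "g (Suc k) = c i" using vertex by blast
  have edge: "{c i, g k} \<in> X" "{c i, g (k + 2)} \<in> X"
    using adj[of k] adj[of "Suc k"] by (simp_all add: i(2) insert_commute)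
  have "g k \<noteq> g (k + 2)" using neq[of 2 k] m by simp
  then have iAB: "i \<in> left_ends X \<inter> right_ends X" and v: "g (k + 2) \<in> {a, b}"
    using neighbour_of_c[OF X edge(1) i(1)] neighbour_of_c[OF X edge(2) i(1)] by auto
  have pos: "card (left_ends X \<inter> right_ends X) \<ge> 1"
    using iAB by (metis One_nat_def Suc_leI card_gt_0_iff empty_iff fin(1) finite_Int)
  have e3: "{g (k + 2), g (k + 3)} \<in> X" using adj[of "k + 2"] by (simp add: numeral_eq_Suc)
  have e4: "{g (k + 3), g (k + 4)} \<in> X" using adj[of "k + 3"] by (simp add: numeral_eq_Suc)
  have n3: "g (k + 2) \<noteq> g (k + 3)" using neq[of 1 "k + 2"] m by (simp add: numeral_eq_Suc)
  show ?thesis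
  proof (cases "g (k + 3) \<in> {a, b}")
    case True
    then have "{g (k + 2), g (k + 3)} = {a, b}" using n3 v by auto
    then have "{a, b} \<in> X" using e3 by simp
    then show ?thesis using pos by (simp add: links_def)
  next
    case False
    then obtain j where j: "j < n" "g (k + 3) = c j" using vertex by blast
    have "c i \<noteq> c j" using neq[of 2 "Suc k"] m i(2) j(2) by (simp add: numeral_eq_Suc)
    then have "i \<noteq> j" by blast
    have edge': "{c j, g (k + 2)} \<in> X" "{c j, g (k + 4)} \<in> X"
      using e3 e4 unfolding j(2) by (simp_all add: insert_commute)
    have "g (k + 2) \<noteq> g (k + 4)" using neq[of 2 "k + 2"] m by (simp add: numeral_eq_Suc)
    then have "j \<in> left_ends X \<inter> right_ends X"
      using neighbour_of_c[OF X edge'(1) j(1)] neighbour_of_c[OF X edge'(2) j(1)] by auto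
    then have "card {i, j} \<le> card (left_ends X \<inter> right_ends X)" using iAB by (intro card_mono) auto
    then show ?thesis using \<open>i \<noteq> j\<close> by (simp add: links_def)
  qed
qed

lemma graphic_matroid_eq_thag_matroid: "graphic_matroid edges = thag_matroid"
proof -
  have "(\<nexists>vs. is_cycle X vs) \<longleftrightarrow> links X \<le> 1" if "X \<subseteq> edges" for X
    using cycle_if_two_links[of X] two_links_if_cycle[OF that] by (metis not_less_eq_eq numeral_2_eq_2 One_nat_def)
  then have "{X. X \<subseteq> edges \<and> (\<nexists>vs. is_cycle X vs)} = {X. X \<subseteq> edges \<and> links X \<le> 1}"
    by (intro Collect_cong) blast
  then show ?thesis by (simp add: graphic_matroid_def thag_matroid_def)
qed

end

lemma complete_multipartiteI:
  assumes "i < length ns" "k < ns ! i" "j < length ns" "l < ns ! j" "i \<noteq> j"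
  shows "{(i, k), (j, l)} \<in> complete_multipartite ns"
  using assms unfolding complete_multipartite_def by blast

lemma complete_multipartiteE:
  assumes "e \<in> complete_multipartite ns"
  obtains i k j l where "e = {(i, k), (j, l)}"
    "i < length ns" "k < ns ! i" "j < length ns" "l < ns ! j" "i \<noteq> j"
  using assms unfolding complete_multipartite_def by blast

lemma complete_multipartite_1_1_n:
  "complete_multipartite [1, 1, n] =
     (\<lambda>i. {(0, 0), (2, i)}) ` {..<n} \<union> (\<lambda>i. {(1, 0), (2, i)}) ` {..<n} \<union> {{(0, 0), (1, 0)}}"
  (is "?K = ?E")
proof
  show "?K \<subseteq> ?E"
  proof
    fix e assume "e \<in> ?K"
    then obtain i k j l where e: "e = {(i, k), (j, l)}" "i < length [1, 1, n]" "k < [1, 1, n] ! i"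
      "j < length [1, 1, n]" "l < [1, 1, n] ! j" "i \<noteq> j"
      by (rule complete_multipartiteE)
    have "i = 0 \<or> i = 1 \<or> i = 2" "j = 0 \<or> j = 1 \<or> j = 2" using e(2,4) by auto
    then show "e \<in> ?E" using e(1,3,5,6) by (elim disjE) (auto simp: insert_commute)
  qed
  have "{(0, 0), (2, i)} \<in> ?K" "{(1, 0), (2, i)} \<in> ?K" if "i < n" for i
    by (rule complete_multipartiteI; use that in simp)+
  moreover have "{(0, 0), (1, 0)} \<in> ?K" by (rule complete_multipartiteI) simp_all
  ultimately show "?E \<subseteq> ?K" by blast
qed

lemma complete_multipartite_2_n:
  "complete_multipartite [2, n] =
     (\<lambda>i. {(0, 0), (1, i)}) ` {..<n} \<union> (\<lambda>i. {(0, 1), (1, i)}) ` {..<n}"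
  (is "?K = ?E")
proof
  show "?K \<subseteq> ?E"
  proof
    fix e assume "e \<in> ?K"
    then obtain i k j l where e: "e = {(i, k), (j, l)}" "i < length [2, n]" "k < [2, n] ! i"
      "j < length [2, n]" "l < [2, n] ! j" "i \<noteq> j"
      by (rule complete_multipartiteE)
    have "i = 0 \<and> j = 1 \<or> i = 1 \<and> j = 0" using e(2,4,6) by auto
    then show "e \<in> ?E" using e(1,3,5)
      by (elim disjE conjE) (auto simp: insert_commute less_2_cases_iff)
  qed
  have "{(0, 0), (1, i)} \<in> ?K" "{(0, 1), (1, i)} \<in> ?K" if "i < n" for i
    by (rule complete_multipartiteI; use that in simp)+
  then show "?E \<subseteq> ?K" by blast
qed

lemma thagomizer_graph_1_1_n:
  "n \<ge> 2 \<Longrightarrow> thagomizer_graph (0, 0) (1, 0) (\<lambda>i. (2 :: nat, i)) n"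
  by unfold_locales (auto simp: inj_on_def)

lemma thagomizer_graph_2_n:
  "n \<ge> 2 \<Longrightarrow> thagomizer_graph (0, 0) (0, 1) (\<lambda>i. (1 :: nat, i)) n"
  by unfold_locales (auto simp: inj_on_def)

theorem theorem1p2:
  fixes n :: nat
  assumes "n \<ge> 2"
  shows "\<forall>P \<in> {KL_poly (graphic_matroid (complete_multipartite [1, 1, n])),
                KL_poly (graphic_matroid (complete_multipartite [2, n]))}.
           card {z :: complex. poly (map_poly of_int P) z = 0} = n div 2 \<and>
           (\<forall>z :: complex. poly (map_poly of_int P) z = 0 \<longrightarrow>
              z \<in> \<real> \<and> Re z < 0 \<and> order z (map_poly of_int P) = 1)"
proof -
  have K11n: "KL_poly (graphic_matroid (complete_multipartite [1, 1, n])) = thag_poly n"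
  proof -
    interpret thagomizer_graph "(0, 0)" "(1, 0)" "\<lambda>i. (2 :: nat, i)" n True
      by (rule thagomizer_graph_1_1_n[OF assms])
    have "complete_multipartite [1, 1, n] = edges"
      unfolding complete_multipartite_1_1_n edges_def by simp
    then show ?thesis using graphic_matroid_eq_thag_matroid KL_poly_thag_matroid by simp
  qed
  have K2n: "KL_poly (graphic_matroid (complete_multipartite [2, n])) = thag_poly n + [:0, 1:]"
  proof -
    interpret thagomizer_graph "(0, 0)" "(0, 1)" "\<lambda>i. (1 :: nat, i)" n False
      by (rule thagomizer_graph_2_n[OF assms])
    have "complete_multipartite [2, n] = edges"
      unfolding complete_multipartite_2_n edges_def by simp
    then show ?thesis using graphic_matroid_eq_thag_matroid KL_poly_thag_matroid by simp
  qed
  have zeros: "card {z :: complex. poly (map_poly of_int P) z = 0} = n div 2 \<and>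
      (\<forall>z :: complex. poly (map_poly of_int P) z = 0 \<longrightarrow>
         z \<in> \<real> \<and> Re z < 0 \<and> order z (map_poly of_int P) = 1)"
    if "descending_negative_roots (real_poly P) \<sigma>" "lead_coeff P > 0" "degree P = n div 2" for P \<sigma>
    using simple_negative_zeros[OF that(1,2)] that(3) by simp
  have "lead_coeff (thag_poly n) > 0" using coeff_thag_top by (simp add: degree_thag)
  then show ?thesis
    unfolding K11n K2n
    using zeros thag_roots[of n] thag_plus_X_roots[OF assms] thag_plus_X_top[OF assms] degree_thag[of n]
    by (metis (no_types, lifting) insertE singletonD)
qed

end
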